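(* Let $n$ be an odd integer, $q=2^n$, and let $i$ be a positive integer with $\gcd(i,n)=1$. Let $s=2^{2i}-2^i+1$ and \[B=\mathrm{GF}(q)\setminus\left\{\big((x+1)^s+x^s+1\big)^{\frac{1}{2^i+1}}: x\in\mathrm{GF}(q)\right\}.\] Then the incidence structure $(\mathrm{GF}(q),\mathrm{GA}_1(q)(B))$ is a $3$-$\left(q,\frac q2,\frac{q(q-4)}{8}\right)$ design.
   Context: For an integer $e$ with $\gcd(e,q-1)=1$, $\frac1e$ as an exponent denotes the inverse of $e$ modulo $q-1$ (here $\gcd(2^i+1,q-1)=1$). $\mathrm{GA}_1(q)$ is the group of permutations $x\mapsto ax+b$ of $\mathrm{GF}(q)$ with $(a,b)\in\mathrm{GF}(q)^*\times\mathrm{GF}(q)$; $\mathrm{GA}_1(q)(B)=\{\pi(B):\pi\in\mathrm{GA}_1(q)\}$, with incidence given by membership. A $3$-$(v,k,\lambda)$ design is a pair $(\mathcal P,\mathcal B)$ with $|\mathcal P|=v$, $\mathcal B$ a set of $k$-subsets of $\mathcal P$, such that every $3$-subset of $\mathcal P$ is contained in exactly $\lambda$ members of $\mathcal B$. *)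

theory Defs
  imports "HOL-Number_Theory.Number_Theory"
begin

text \<open>Exponent 1/e: the inverse of e modulo m = q-1, taken as the least positive
  representative (so that 0 maps to 0 and the map is a bijection when gcd(e,m)=1).\<close>
definition inv_exp :: "nat \<Rightarrow> nat \<Rightarrow> nat" where
  "inv_exp e m = (LEAST d. 0 < d \<and> [e * d = 1] (mod m))"

definition GA1_orbit :: "'a::field set \<Rightarrow> 'a set set" where
  "GA1_orbit B = {(\<lambda>x. a * x + b) ` B | a b. a \<noteq> 0}"

definition design3 :: "'a set \<Rightarrow> 'a set set \<Rightarrow> nat \<Rightarrow> nat \<Rightarrow> real \<Rightarrow> bool" where
  "design3 P Bs v k lam \<longleftrightarrow>
     card P = v \<and> (\<forall>B\<in>Bs. B \<subseteq> P \<and> card B = k) \<and>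
     (\<forall>T. T \<subseteq> P \<and> card T = 3 \<longrightarrow> real (card {B\<in>Bs. T \<subseteq> B}) = lam)"

end

theory Submission
  imports Defs
begin

text \<open>
  Write \<open>\<sigma> = 2 ^ i\<close>, \<open>\<chi>(x) = (-1) ^ Tr x\<close> and let \<open>F\<close> be \<open>-1\<close> on \<open>B\<close> and \<open>1\<close> elsewhere. Since only
  \<open>x \<mapsto> x ^ \<sigma>\<close> matters, \<open>i\<close> may be replaced by \<open>i + n\<close>, so \<open>i\<close> is odd without loss of generality.

  \<^item> From \<open>(x + 1) ^ s + x ^ s + 1 = (x ^ \<sigma> + x) ^ (\<sigma> + 1) / (x\<^sup>2 + x) ^ \<sigma>\<close> one finds a bijection
    between \<open>w\<close> and \<open>y\<close>, given by \<open>w ^ \<sigma>\<^sup>2 + y\<^sup>2 w ^ \<sigma> + w = y\<close> and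
    \<open>Tr (y w ^ \<sigma>) = Tr (w ^ (\<sigma> + 1))\<close>, under which \<open>F(y) = \<chi>(w ^ (\<sigma> + 1))\<close>.

  \<^item> As the equation is affine in \<open>w\<close>, the Walsh transform of \<open>F\<close> at \<open>\<lambda>\<close> becomes half of the sum of
    \<open>\<chi>(Tr (a ^ (\<sigma> + 1)))\<close> over the elements \<open>a\<close> of norm \<open>\<lambda>\<^sup>2\<close> in the algebras \<open>GF(q) \<times> GF(q)\<close> and
    \<open>GF(q\<^sup>2)\<close>. On norm-one elements the powers \<open>\<sigma> + 1\<close> and \<open>3\<close> are equidistributed, which reduces
    to \<open>\<sigma> = 2\<close> and gives \<open>W(\<lambda>) = (\<Sum>z. \<chi>(\<lambda> ^ (\<sigma> + 1) (z\<^sup>3 + z)))\<close> for \<open>\<lambda> \<noteq> 0\<close>.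

  \<^item> The triple correlations of \<open>F\<close> along \<open>GA\<^sub>1(q)\<close> vanish iff for \<open>t\<^sub>1 + t\<^sub>2 + t\<^sub>3 = 0\<close>, \<open>t\<^sub>j \<noteq> 0\<close>, the
    affine cubic surface \<open>(\<Sum>j. t\<^sub>j ^ (\<sigma> + 1) (z\<^sub>j\<^sup>3 + z\<^sub>j)) = 0\<close> has \<open>q\<^sup>2\<close> points. It has a double point
    \<open>(1, 1, 1)\<close>; projecting from it reduces the count to showing that a plane cubic meets a line in one
    point. With \<open>t\<^sub>j = p\<^sub>j\<^sup>2\<close>, the line is spanned by \<open>(1 / p\<^sub>j)\<close> and \<open>(1 / p\<^sub>j ^ \<sigma>)\<close>, and in these
    coordinates the cubic is \<open>\<alpha> \<xi>\<^sup>3 + \<beta> \<eta>\<^sup>3\<close>.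

  \<^item> \<open>B\<close> has trivial stabiliser in \<open>GA\<^sub>1(q)\<close>: translations are excluded by Parseval together with
    \<open>W(0) = 0\<close> and \<open>W\<^sup>2 \<le> 2 q\<close>, the other elements by \<open>|B| = q / 2\<close>.
\<close>

subsection \<open>Sums, powers and affine images\<close>

lemma sum_pairs: "(\<Sum>p\<in>UNIV. f (fst p) (snd p)) = (\<Sum>a\<in>UNIV. \<Sum>b\<in>UNIV. f a b)"
  for f :: "'b::finite \<Rightarrow> 'c::finite \<Rightarrow> 'd::comm_monoid_add"
  by (simp add: sum.cartesian_product case_prod_unfold flip: UNIV_Times_UNIV)

lemma prod_of_three_sums:
  fixes f g h :: "'b::finite \<Rightarrow> real"
  shows "(\<Sum>x\<in>UNIV. f x) * (\<Sum>y\<in>UNIV. g y) * (\<Sum>z\<in>UNIV. h z) =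
    (\<Sum>x\<in>UNIV. \<Sum>y\<in>UNIV. \<Sum>z\<in>UNIV. f x * g y * h z)"
proof -
  have "(\<Sum>x\<in>UNIV. f x) * (\<Sum>y\<in>UNIV. g y) * (\<Sum>z\<in>UNIV. h z) =
      (\<Sum>x\<in>UNIV. (\<Sum>y\<in>UNIV. f x * g y) * (\<Sum>z\<in>UNIV. h z))"
    unfolding sum_product[of f] by (rule sum_distrib_right)
  also have "\<dots> = (\<Sum>x\<in>UNIV. \<Sum>y\<in>UNIV. \<Sum>z\<in>UNIV. f x * g y * h z)"
    by (intro sum.cong refl sum_product)
  finally show ?thesis .
qed

lemma sum_swap_3:
  fixes f :: "'b::finite \<Rightarrow> 'c::finite \<Rightarrow> 'd::finite \<Rightarrow> 'e::finite \<Rightarrow> real"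
  shows "(\<Sum>s\<in>UNIV. \<Sum>x\<in>UNIV. \<Sum>y\<in>UNIV. \<Sum>z\<in>UNIV. f s x y z) =
    (\<Sum>x\<in>UNIV. \<Sum>y\<in>UNIV. \<Sum>z\<in>UNIV. \<Sum>s\<in>UNIV. f s x y z)"
proof -
  have "(\<Sum>s\<in>UNIV. \<Sum>x\<in>UNIV. \<Sum>y\<in>UNIV. \<Sum>z\<in>UNIV. f s x y z) =
    (\<Sum>x\<in>UNIV. \<Sum>s\<in>UNIV. \<Sum>y\<in>UNIV. \<Sum>z\<in>UNIV. f s x y z)"
    by (rule sum.swap)
  also have "\<dots> = (\<Sum>x\<in>UNIV. \<Sum>y\<in>UNIV. \<Sum>s\<in>UNIV. \<Sum>z\<in>UNIV. f s x y z)"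
    by (intro sum.cong refl sum.swap)
  also have "\<dots> = (\<Sum>x\<in>UNIV. \<Sum>y\<in>UNIV. \<Sum>z\<in>UNIV. \<Sum>s\<in>UNIV. f s x y z)"
    by (intro sum.cong refl sum.swap)
  finally show ?thesis .
qed

text \<open>Each of the two power maps on \<open>U\<close> factors through the other. Multiplication
  by \<open>t\<close>, the quotient of \<open>a ^ e\<close> by a chosen \<open>a\<close> with
  \<open>a ^ m = c\<close>, carries one fibre injectively into the other; used in both directions,
  this makes the two powers equidistributed.\<close>

lemma card_power_fibre_le:
  fixes U :: "'b::comm_monoid_mult set"
  assumes "finite U"
    and closed: "\<And>a b. a \<in> U \<Longrightarrow> b \<in> U \<Longrightarrow> a * b \<in> U"
    and inverse: "\<And>a. a \<in> U \<Longrightarrow> \<exists>b\<in>U. a * b = 1"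
    and "\<And>a. a \<in> U \<Longrightarrow> a ^ m = a ^ (k * e)" and "\<And>a. a \<in> U \<Longrightarrow> a ^ k = a ^ (m * g)"
  shows "card {a \<in> U. a ^ m = c} \<le> card {a \<in> U. a ^ k = c}"
proof (cases "{a \<in> U. a ^ m = c} = {}")
  case False
  then obtain a where a: "a \<in> U" "a ^ m = c" by blast
  obtain b where b: "b \<in> U" "a * b = 1" using inverse a by blast
  have pow: "x ^ Suc j \<in> U" if "x \<in> U" for x j
    using that by (induction j) (auto intro: closed)
  have "1 \<in> U" using closed a b by metis
  then have pow: "x ^ j \<in> U" if "x \<in> U" for x j
    using pow[OF that] by (cases j) auto
  define t where "t = b * a ^ e"
  have t: "t \<in> U" unfolding t_def using closed pow a b by blast
  then obtain t' where t': "t * t' = 1" using inverse by blast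
  have "inj_on (\<lambda>x. x * t) {a \<in> U. a ^ m = c}"
    by (rule inj_onI) (metis t' mult.assoc mult_1_right)
  moreover have "(\<lambda>x. x * t) ` {a \<in> U. a ^ m = c} \<subseteq> {a \<in> U. a ^ k = c}"
  proof clarify
    fix x assume x: "x \<in> U" "c = x ^ m"
    then have "x ^ k = a ^ k"
      using a assms(5) by (metis power_mult)
    then have "(x * t) ^ k = (a * b) ^ k * a ^ (k * e)"
      by (simp add: t_def power_mult_distrib power_mult[symmetric] mult.commute[of e] mult.assoc)
    also have "\<dots> = x ^ m" using a b x assms(4) by simp
    finally show "x * t \<in> U \<and> (x * t) ^ k = x ^ m" using closed x t by blast
  qed
  ultimately show ?thesis using assms(1) by (simp add: card_inj_on_le)
next
  case True
  then show ?thesis by (simp only: card.empty)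
qed

lemma sum_power_cong:
  fixes U :: "'b::comm_monoid_mult set" and f :: "'b \<Rightarrow> real"
  assumes "finite U"
    and "\<And>a b. a \<in> U \<Longrightarrow> b \<in> U \<Longrightarrow> a * b \<in> U"
    and "\<And>a. a \<in> U \<Longrightarrow> \<exists>b\<in>U. a * b = 1"
    and "\<And>a. a \<in> U \<Longrightarrow> a ^ m = a ^ (k * e)" and "\<And>a. a \<in> U \<Longrightarrow> a ^ k = a ^ (m * g)"
  shows "(\<Sum>a\<in>U. f (a ^ m)) = (\<Sum>a\<in>U. f (a ^ k))"
proof -
  let ?T = "(\<lambda>a. a ^ m) ` U \<union> (\<lambda>a. a ^ k) ` U"
  have *: "(\<Sum>a\<in>U. f (a ^ j)) = (\<Sum>c\<in>?T. of_nat (card {a\<in>U. a ^ j = c}) * f c)" if "j \<in> {m, k}" for j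
  proof -
    have "(\<Sum>a\<in>U. f (a ^ j)) = (\<Sum>c\<in>?T. \<Sum>a | a \<in> U \<and> a ^ j = c. f (a ^ j))"
      using assms(1) that by (intro sum.group[symmetric]) auto
    also have "\<dots> = (\<Sum>c\<in>?T. of_nat (card {a\<in>U. a ^ j = c}) * f c)"
      by (intro sum.cong refl) simp
    finally show ?thesis .
  qed
  have "card {a \<in> U. a ^ m = c} = card {a \<in> U. a ^ k = c}" for c
    using card_power_fibre_le[OF assms(1-3), of m k e g c] card_power_fibre_le[OF assms(1-3), of k m g e c]
      assms(4,5) by force
  then show ?thesis using *[of m] *[of k] by simp
qed

text \<open>Because \<open>x\<close> is \<open>- 1\<close> modulo \<open>x + 1\<close>. It will show
  that \<open>3\<close> divides \<open>2 ^ i + 1\<close> and that \<open>2 ^ i + 1\<close> divides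
  \<open>(2 ^ i) ^ j + 1\<close>.\<close>

lemma plus_1_dvd_odd_power_plus_1:
  assumes "odd m"
  shows "(x + 1) dvd (x ^ m + 1 :: nat)"
proof -
  have "(int x - (- 1)) dvd (int x ^ m - (- 1) ^ m)"
    by (metis dvd_triv_left power_diff_sumr2)
  then have "int (x + 1) dvd int (x ^ m + 1)"
    using assms by (simp add: add.commute)
  then show ?thesis by (simp only: int_dvd_int_iff)
qed

lemma inv_exp_cong:
  assumes "coprime e m" "0 < m"
  shows "0 < inv_exp e m" "[e * inv_exp e m = 1] (mod m)"
proof -
  obtain d where "[e * d = 1] (mod m)"
    using cong_solve_coprime_nat[OF assms(1)] by auto
  \<comment> \<open>Adding \<open>m\<close> makes the solution positive even if
    \<open>d = 0\<close>, which can occur for \<open>m = 1\<close>.\<close>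
  then have "[e * (d + m) = 1] (mod m)"
    by (simp add: cong_def distrib_left)
  then have "\<exists>d. 0 < d \<and> [e * d = 1] (mod m)"
    using assms(2) by (intro exI[of _ "d + m"]) auto
  then have "0 < inv_exp e m \<and> [e * inv_exp e m = 1] (mod m)"
    unfolding inv_exp_def by (rule LeastI_ex)
  then show "0 < inv_exp e m" "[e * inv_exp e m = 1] (mod m)" by auto
qed

lemma GA1_orbit_eq:
  "GA1_orbit B = (\<lambda>q. (\<lambda>x. fst q * x + snd q) ` B) ` {q. fst q \<noteq> 0}"
proof (rule Set.set_eqI)
  fix X
  show "X \<in> GA1_orbit B \<longleftrightarrow> X \<in> (\<lambda>q. (\<lambda>x. fst q * x + snd q) ` B) ` {q. fst q \<noteq> 0}"
    unfolding GA1_orbit_def image_iff[of X] Bex_def mem_Collect_eq split_paired_Ex fst_conv snd_conv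
    by blast
qed

subsection \<open>Finite fields with an odd power of two elements\<close>

locale odd_binary_field =
  fixes ty :: "'a::{field,finite} itself" and n :: nat
  assumes odd_n: "odd n" and card_field: "card (UNIV :: 'a set) = 2 ^ n"
begin

section \<open>Characteristic two and Fermat's theorem\<close>

lemma n_pos: "0 < n"
  using odd_n by (cases n) auto

text \<open>Translation by 1 permutes the field, so adding \<open>2 ^ n\<close> copies of 1 leaves
  the sum of all elements unchanged.\<close>

lemma two_eq_zero: "(2::'a) = 0"
proof -
  have "(\<Sum>x\<in>UNIV. x::'a) = (\<Sum>x\<in>UNIV. x + 1)"
    by (rule sum.reindex_bij_witness[of _ "\<lambda>x. x + 1" "\<lambda>x. x - 1"]) auto
  then have "of_nat (card (UNIV :: 'a set)) = (0::'a)"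
    by (simp add: sum.distrib)
  then have "(2::'a) ^ n = 0"
    by (simp add: card_field)
  then show ?thesis by simp
qed

lemma add_self [simp]: "x + x = (0::'a)"
  using two_eq_zero by (metis mult_2 mult_zero_left)

lemma add_self_left [simp]: "x + (x + y) = (y::'a)"
  by (simp flip: add.assoc)

lemma uminus_eq [simp]: "- x = (x::'a)"
  by (simp add: minus_unique)

lemma minus_eq [simp]: "x - y = x + (y::'a)"
  by (metis add_uminus_conv_diff uminus_eq)

lemma add_eq_0_iff_eq: "x + y = 0 \<longleftrightarrow> x = (y::'a)"
  by (metis add_self add_left_cancel)

lemma add_eq_add_swap: "x + y = z + w \<Longrightarrow> x + z = y + (w::'a)"
  by (metis add.assoc add.commute add_self_left)

lemma square_add: "(x + y) ^ 2 = x ^ 2 + (y::'a) ^ 2"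
  by (simp add: power2_sum two_eq_zero)

text \<open>Scaling permutes \<open>S\<close>, hence fixes the nonzero product of its elements.
  Apart from Fermat's theorem this also serves to exclude stabilising elements of the block.\<close>

lemma power_card_eq_1_if_scale_invariant:
  fixes a :: 'a
  assumes "(\<lambda>x. a * x) ` S = S" "0 \<notin> S" "a \<noteq> 0"
  shows "a ^ card S = 1"
proof -
  have "\<Prod>S = (\<Prod>x\<in>(\<lambda>x. a * x) ` S. x)"
    using assms by simp
  also have "\<dots> = (\<Prod>x\<in>S. a * x)"
    using assms by (subst prod.reindex) (auto simp: inj_on_def)
  also have "\<dots> = a ^ card S * \<Prod>S"
    by (simp add: prod.distrib)
  finally have *: "\<Prod>S = a ^ card S * \<Prod>S" .
  have "\<Prod>S \<noteq> 0" using assms by simp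
  with * show ?thesis by simp
qed

lemma power_q_minus_1:
  assumes "(a::'a) \<noteq> 0"
  shows "a ^ (2 ^ n - 1) = 1"
proof -
  have "(\<lambda>x. a * x) ` (UNIV - {0}) = UNIV - {0}"
  proof -
    have "x \<in> (\<lambda>x. a * x) ` (UNIV - {0})" if "x \<noteq> 0" for x
      using assms that by (intro image_eqI[of _ _ "x / a"]) auto
    then show ?thesis using assms by auto
  qed
  from power_card_eq_1_if_scale_invariant[OF this] assms show ?thesis
    by (simp add: card_Diff_singleton card_field)
qed

lemma power_q: "(a::'a) ^ (2 ^ n) = a"
proof (cases "a = 0")
  case False
  have "a ^ (2 ^ n) = a ^ Suc (2 ^ n - 1)" by simp
  also have "\<dots> = a" unfolding power_Suc using False power_q_minus_1 by simp
  finally show ?thesis .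
qed simp

section \<open>Powers of the Frobenius automorphism\<close>

definition fr :: "nat \<Rightarrow> 'a \<Rightarrow> 'a" where
  "fr k x = x ^ (2 ^ k)"

lemma fr_0_eq [simp]: "fr 0 x = x"
  by (simp add: fr_def)

lemma fr_Suc: "fr (Suc k) x = (fr k x) ^ 2"
  by (simp add: fr_def mult.commute flip: power_mult)

lemma fr_1_eq: "fr (Suc 0) x = x ^ 2"
  by (simp add: fr_def)

lemma fr_zero [simp]: "fr k 0 = 0" and fr_one [simp]: "fr k 1 = 1"
  by (simp_all add: fr_def)

lemma fr_add [simp]: "fr k (x + y) = fr k x + fr k y"
  by (induction k) (simp_all add: fr_Suc square_add)

lemma fr_mult [simp]: "fr k (x * y) = fr k x * fr k y"
  by (simp add: fr_def power_mult_distrib)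

lemma fr_divide [simp]: "fr k (x / y) = fr k x / fr k y"
  by (simp add: fr_def power_divide)

lemma fr_power [simp]: "fr k (x ^ m) = fr k x ^ m"
  by (simp add: fr_def mult.commute flip: power_mult)

lemma fr_fr: "fr k (fr l x) = fr (k + l) x"
  by (simp add: fr_def power_add mult.commute flip: power_mult)

lemma fr_commute: "fr k (fr l x) = fr l (fr k x)"
  by (simp add: fr_fr add.commute)

lemma fr_eq_0_iff [simp]: "fr k x = 0 \<longleftrightarrow> x = 0"
  by (simp add: fr_def)

lemma fr_n [simp]: "fr n x = x"
  by (simp add: fr_def power_q)

lemma fr_n_mult: "fr (n * m) x = x"
  by (induction m) (simp_all flip: fr_fr)

lemma fr_mod: "fr (k mod n) x = fr k x"
  by (metis fr_fr fr_n_mult mod_mult_div_eq)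

lemma fr_cong: "[k = l] (mod n) \<Longrightarrow> fr k x = fr l x"
  by (metis cong_def fr_mod)

lemma fr_eq_iff [simp]: "fr k x = fr k y \<longleftrightarrow> x = y"
  by (metis add_eq_0_iff_eq fr_add fr_eq_0_iff)

lemma bij_fr: "bij (fr k)"
  by (simp add: finite_UNIV_inj_surj inj_def bij_def)

text \<open>A power of \<open>fr k\<close> is the squaring map when \<open>k\<close> is invertible
  modulo \<open>n\<close>, so a fixed point lies in the prime field.\<close>

lemma fr_fixed:
  assumes "coprime k n" "fr k x = x"
  shows "x = 0 \<or> x = 1"
proof -
  obtain a where "[k * a = 1] (mod n)"
    using cong_solve_coprime_nat[OF assms(1)] by auto
  then have "fr (k * a) x = x ^ 2"
    using fr_cong fr_1_eq by (metis One_nat_def)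
  moreover have "fr (k * a) x = x"
    using assms(2) by (induction a) (simp_all flip: fr_fr)
  ultimately show ?thesis
    by (simp add: power2_eq_square)
qed

section \<open>The absolute trace and the canonical additive character\<close>

definition tr :: "'a \<Rightarrow> 'a" where
  "tr x = (\<Sum>k<n. fr k x)"

lemma tr_add [simp]: "tr (x + y) = tr x + tr y"
  by (simp add: tr_def sum.distrib)

lemma tr_power2: "tr (x ^ 2) = tr x"
proof -
  have "tr (x ^ 2) = (\<Sum>k<n. fr (Suc k) x)"
    by (simp add: tr_def fr_Suc)
  also have "\<dots> + fr 0 x = tr x + fr n x"
    unfolding tr_def using sum.lessThan_Suc_shift[of "\<lambda>k. fr k x" n] sum.lessThan_Suc[of "\<lambda>k. fr k x" n]
    by (simp add: add.commute del: fr_n)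
  finally show ?thesis by simp
qed

lemma tr_square: "(tr x) ^ 2 = tr x"
proof -
  have "(tr x) ^ 2 = fr 1 (tr x)" by (simp add: fr_1_eq)
  also have "\<dots> = (\<Sum>k<n. fr 1 (fr k x))"
  proof -
    have "fr 1 (sum f A) = (\<Sum>k\<in>A. fr 1 (f k))" for f :: "nat \<Rightarrow> 'a" and A
      by (induction A rule: infinite_finite_induct) simp_all
    then show ?thesis by (simp add: tr_def)
  qed
  also have "\<dots> = tr (x ^ 2)"
    by (simp add: tr_def fr_1_eq)
  finally show ?thesis by (simp add: tr_power2)
qed

lemma tr_cases: "tr x = 0 \<or> tr x = 1"
  using tr_square[of x] by (simp add: power2_eq_square)

lemma of_nat_odd: "odd m \<Longrightarrow> of_nat m = (1::'a)"
  by (auto elim!: oddE simp: two_eq_zero)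

lemma tr_one: "tr 1 = 1"
  by (simp add: tr_def of_nat_odd odd_n)

definition chi :: "'a \<Rightarrow> real" where
  "chi x = (if tr x = 0 then 1 else - 1)"

lemma chi_add: "chi (x + y) = chi x * chi y"
  using tr_cases[of x] tr_cases[of y] by (auto simp: chi_def)

lemma chi_zero [simp]: "chi 0 = 1"
  using chi_add[of 0 0] by (auto simp: chi_def split: if_splits)

lemma chi_one [simp]: "chi 1 = - 1"
  by (simp add: chi_def tr_one)

lemma chi_cases: "chi x = 1 \<or> chi x = - 1"
  by (simp add: chi_def)

lemma chi_mult_self [simp]: "chi x * chi x = 1"
  by (simp add: chi_def)

lemma chi_square: "chi (x ^ 2) = chi x"
  by (simp add: chi_def tr_power2)

lemma chi_fr [simp]: "chi (fr k x) = chi x"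
  by (induction k) (simp_all add: fr_Suc chi_square)

lemma sum_chi: "(\<Sum>x\<in>UNIV. chi x) = 0"
proof -
  have "(\<Sum>x\<in>UNIV. chi x) = (\<Sum>x\<in>UNIV. chi (x + 1))"
    by (rule sum.reindex_bij_witness[of _ "\<lambda>x. x + 1" "\<lambda>x. x + 1"]) (auto simp: add.assoc)
  then show ?thesis by (simp add: chi_add sum_negf)
qed

lemma sum_chi_mult: "(\<Sum>x\<in>UNIV. chi (a * x)) = (if a = 0 then 2 ^ n else 0)"
proof (cases "a = 0")
  case False
  have "(\<Sum>x\<in>UNIV. chi (a * x)) = (\<Sum>x\<in>UNIV. chi x)"
    using False by (intro sum.reindex_bij_witness[of _ "\<lambda>x. x / a" "\<lambda>x. a * x"]) auto
  with False show ?thesis by (simp add: sum_chi)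
qed (simp add: card_field)

lemma sum_chi_mult': "(\<Sum>x\<in>UNIV. chi (x * a)) = (if a = 0 then 2 ^ n else 0)"
  using sum_chi_mult[of a] by (simp add: mult.commute)

lemma chi_eq_1_obtain:
  assumes "chi v = 1"
  obtains x where "x ^ 2 + x = v"
proof -
  obtain m where m: "n = 2 * m + 1" using odd_n by (elim oddE)
  \<comment> \<open>For odd \<open>n\<close> the half trace \<open>v + v ^ 4 + v ^ 16 + \<dots> + v ^ (2 ^ (n - 1))\<close> is a solution.\<close>
  define H where "H k = (\<Sum>l<k. fr (2 * l) v)" for k
  have H: "(H k) ^ 2 + H k = (\<Sum>l<2 * k. fr l v)" for k
    by (induction k) (simp_all add: H_def square_add fr_Suc algebra_simps)
  have "tr v = (\<Sum>l<2 * m + 1. fr l v)"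
    unfolding tr_def by (rule sum.cong) (simp_all add: m)
  then have "(H (Suc m)) ^ 2 + H (Suc m) = tr v + fr (2 * m + 1) v"
    unfolding H by simp
  also have "fr (2 * m + 1) v = v"
    using fr_n unfolding m .
  also have "tr v + v = v"
    using assms by (simp add: chi_def split: if_splits)
  finally show ?thesis using that by blast
qed

subsection \<open>The complement of the block as a function\<close>

lemma gold_eq_0_iff [simp]: "x * fr i x = 0 \<longleftrightarrow> x = 0"
  by simp

text \<open>The quotient \<open>z\<close> satisfies \<open>z * fr i z = 1\<close>, hence is fixed by
  \<open>fr (i + i)\<close>. Since \<open>n\<close> is odd, \<open>2 * i\<close> is still coprime to
  \<open>n\<close>, which leaves only \<open>z = 1\<close>.\<close>

lemma gold_inj:
  assumes "coprime i n" "x * fr i x = y * fr i y"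
  shows "x = y"
proof (cases "y = 0")
  case True
  then show ?thesis using assms(2) by simp
next
  case False
  define z where "z = x / y"
  have z: "z * fr i z = 1"
    using assms(2) False by (simp add: z_def field_simps)
  then have "fr i z * fr i (fr i z) = 1"
    by (metis fr_mult fr_one)
  with z have "fr (i + i) z = z"
    by (metis fr_fr mult.commute mult_cancel_left mult_zero_left zero_neq_one)
  moreover have "coprime (i + i) n"
    using assms(1) odd_n by (simp flip: mult_2)
  ultimately have "z = 1"
    using fr_fixed z by fastforce
  then show ?thesis using False by (simp add: z_def)
qed

lemma bij_gold:
  assumes "coprime i n"
  shows "bij (\<lambda>x. x * fr i x)"
proof -
  have "inj (\<lambda>x. x * fr i x)"
    by (rule injI) (rule gold_inj[OF assms])
  then show ?thesis by (simp add: bij_def finite_UNIV_inj_surj)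
qed

lemma sum_gold:
  assumes "coprime i n"
  shows "(\<Sum>x\<in>UNIV. f (x * fr i x)) = (\<Sum>x\<in>UNIV. f x)"
  using sum.reindex_bij_betw[OF bij_gold[OF assms], of f] .

section \<open>The bijection between \<open>w\<close> and \<open>y\<close>\<close>

definition rel :: "nat \<Rightarrow> 'a \<Rightarrow> 'a \<Rightarrow> bool" where
  "rel i w y \<longleftrightarrow> fr i (fr i w) + y ^ 2 * fr i w + w = y \<and> chi (y * fr i w) = chi (w * fr i w)"

lemma rel_zero [simp]: "rel i 0 y \<longleftrightarrow> y = 0"
  by (auto simp: rel_def)

text \<open>Multiplying by \<open>fr i w\<close> gives an Artin-Schreier equation for
  \<open>u = y * fr i w\<close>. Its roots differ by 1, and \<open>chi 1 = - 1\<close>, so the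
  condition on \<open>chi\<close> selects exactly one of them.\<close>

lemma rel_iff:
  assumes "w \<noteq> 0"
  shows "rel i w y \<longleftrightarrow> (y * fr i w) ^ 2 + y * fr i w = fr i (w * fr i w) + w * fr i w
           \<and> chi (y * fr i w) = chi (w * fr i w)"
proof -
  have "fr i (fr i w) + y ^ 2 * fr i w + w = y \<longleftrightarrow>
        fr i w * (fr i (fr i w) + y ^ 2 * fr i w + w + y) = 0"
    using assms by (simp add: add_eq_0_iff_eq)
  also have "\<dots> \<longleftrightarrow> (y * fr i w) ^ 2 + y * fr i w + (fr i (w * fr i w) + w * fr i w) = 0"
    by (simp add: algebra_simps power2_eq_square)
  finally show ?thesis by (simp add: rel_def add_eq_0_iff_eq)
qed

lemma rel_unique_right:
  assumes "rel i w y" "rel i w y'"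
  shows "y = y'"
proof (cases "w = 0")
  case False
  define u u' where "u = y * fr i w" and "u' = y' * fr i w"
  have "u ^ 2 + u = u' ^ 2 + u'" and chi: "chi u = chi u'"
    using assms False by (simp_all add: rel_iff u_def u'_def)
  from this(1) have "(u + u') ^ 2 = u + u'"
    unfolding square_add by (rule add_eq_add_swap)
  then have "u + u' = 0 \<or> u + u' = 1"
    by (simp add: power2_eq_square)
  moreover have "u + u' \<noteq> 1"
    using chi chi_add[of u u'] by auto
  ultimately have "u = u'" by (simp add: add_eq_0_iff_eq)
  then show ?thesis using False by (simp add: u_def u'_def)
qed (use assms in simp)

lemma ex_rel_right: "\<exists>y. rel i w y"
proof (cases "w = 0")
  case False
  define v where "v = w * fr i w"
  have "chi (fr i v + v) = 1" by (simp add: chi_add)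
  then obtain u where u: "u ^ 2 + u = fr i v + v" by (rule chi_eq_1_obtain)
  define u' where "u' = (if chi u = chi v then u else u + 1)"
  have "u' ^ 2 + u' = fr i v + v" "chi u' = chi v"
    using u chi_cases[of u] chi_cases[of v] by (auto simp: u'_def square_add chi_add add_ac)
  then have "rel i w (u' / fr i w)"
    using False by (simp add: rel_iff v_def)
  then show ?thesis ..
qed simp

text \<open>The difference \<open>r\<close> of two solutions solves the homogeneous linear equation.
  In terms of its Gold power \<open>\<rho>\<close> and of \<open>j = \<rho> * g\<close>, the two
  equations force \<open>j ^ 2 + \<rho>\<close> into the prime field, and the two character
  conditions then contradict each other.\<close>

lemma rel_unique_left:
  assumes cop: "coprime i n" and "rel i w y" "rel i w' y"
  shows "w = w'"
proof (rule ccontr)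
  assume "w \<noteq> w'"
  define r where "r = w + w'"
  define k where "k = w / r"
  have r: "r \<noteq> 0" using \<open>w \<noteq> w'\<close> by (simp add: r_def add_eq_0_iff_eq)
  have w: "w = r * k" using r by (simp add: k_def)
  have w': "w' = r * k + r" using w by (simp add: r_def)
  define R RR K KK where "R = fr i r" and "RR = fr i R" and "K = fr i k" and "KK = fr i K"
  have E1: "RR * KK + y ^ 2 * (R * K) + r * k = y"
    using assms(2) by (simp add: rel_def w R_def RR_def K_def KK_def)
  have E2: "RR * KK + RR + y ^ 2 * (R * K + R) + (r * k + r) = y"
    using assms(3) by (simp add: rel_def w' R_def RR_def K_def KK_def)
  have C1: "chi (y * (R * K)) = chi (r * k * (R * K))"
    using assms(2) by (simp add: rel_def w R_def K_def)
  have C2: "chi (y * (R * K + R)) = chi ((r * k + r) * (R * K + R))"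
    using assms(3) by (simp add: rel_def w' R_def K_def)
  have "RR + y ^ 2 * R + r = (RR * KK + y ^ 2 * (R * K) + r * k) +
      (RR * KK + RR + y ^ 2 * (R * K + R) + (r * k + r))"
    by (simp add: algebra_simps)
  also have "\<dots> = 0" by (simp only: E1 E2 add_self)
  finally have "y ^ 2 * R + (RR + r) = 0"
    by (simp only: add_ac)
  then have yR: "y ^ 2 * R = RR + r"
    by (simp only: add_eq_0_iff_eq)
  define g \<rho> where "g = K + k" and "\<rho> = r * R"
  define j where "j = \<rho> * g"
  have frg: "fr i g = KK + K" and fr\<rho>: "fr i \<rho> = R * RR"
    by (simp_all add: g_def \<rho>_def K_def KK_def R_def RR_def)
  have "y = RR * KK + (y ^ 2 * R) * K + r * k"
    using E1 by (simp add: mult.assoc)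
  then have y: "y = RR * (KK + K) + r * g"
    unfolding yR by (simp add: algebra_simps g_def)
  have yR1: "y * R = fr i j + j"
    unfolding j_def fr_mult frg fr\<rho> by (subst y) (simp add: algebra_simps \<rho>_def)
  have "(y * R) ^ 2 = y ^ 2 * R * R"
    by (simp add: power2_eq_square algebra_simps)
  also have "\<dots> = fr i \<rho> + \<rho>"
    unfolding yR fr\<rho> by (simp add: algebra_simps \<rho>_def)
  \<comment> \<open>\<open>(y * R) ^ 2\<close> is also the square of \<open>fr i j + j\<close>;
    comparing the two expressions gives a fixed point.\<close>
  finally have "fr i (j ^ 2 + \<rho>) = j ^ 2 + \<rho>"
    unfolding yR1 square_add fr_add fr_power using add_eq_add_swap by blast
  then have eps: "j ^ 2 + \<rho> = 0 \<or> j ^ 2 + \<rho> = 1"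
    by (rule fr_fixed[OF cop])
  have cj: "chi (fr i j * K) = chi (j * k)"
    unfolding K_def by (metis chi_fr fr_mult)
  have "chi (y * (R * K)) = chi (fr i j * K + j * K)"
    by (simp add: yR1 distrib_right flip: mult.assoc)
  also have "\<dots> = chi (j * g)"
    by (simp add: chi_add cj g_def distrib_left)
  finally have C1': "chi (j * g) = chi (\<rho> * k * K)"
    using C1 by (simp add: \<rho>_def mult_ac)
  have "chi (y * (R * K + R)) = chi (y * (R * K)) * chi (y * R)"
    by (simp add: chi_add distrib_left)
  also have "chi (y * R) = 1"
    by (simp add: yR1 chi_add)
  finally have "chi (y * (R * K)) = chi ((r * k + r) * (R * K + R))"
    using C2 by simp
  also have "(r * k + r) * (R * K + R) = r * k * (R * K) + (j + \<rho>)"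
    by (simp add: j_def g_def \<rho>_def algebra_simps)
  finally have "chi (r * k * (R * K)) * chi (j + \<rho>) = chi (r * k * (R * K))"
    by (simp add: C1 chi_add)
  then have "chi (j + \<rho>) = 1"
    using chi_cases[of "r * k * (R * K)"] by auto
  \<comment> \<open>As \<open>chi 1 = - 1\<close>, this excludes the value 1 for
    \<open>j ^ 2 + \<rho>\<close>.\<close>
  then have "chi (j ^ 2 + \<rho>) = 1"
    by (simp add: chi_add chi_square)
  with eps have \<rho>: "\<rho> = j ^ 2"
    by (auto simp: add_eq_0_iff_eq)
  have "j \<noteq> 0" using \<rho> r by (auto simp: \<rho>_def R_def)
  moreover have "j * 1 = j * (j * g)"
    using j_def[unfolded \<rho>] by (simp only: power2_eq_square mult.assoc mult_1_right)
  ultimately have jg: "j * g = 1"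
    by simp
  \<comment> \<open>Since \<open>j * g = 1\<close>, this equals \<open>(j * k) ^ 2 + j * k\<close>,
    of character 1, whereas \<open>chi (j * g) = - 1\<close>.\<close>
  have "\<rho> * k * K = j ^ 2 * k * (k + g)"
    by (simp add: g_def \<rho> two_eq_zero)
  also have "\<dots> = (j * k) ^ 2 + (j * k) * (j * g)"
    by (simp add: power2_eq_square algebra_simps)
  finally have "chi (\<rho> * k * K) = 1"
    by (simp add: jg chi_add chi_square)
  with C1' jg show False by simp
qed

lemma ex_rel_left:
  assumes "coprime i n"
  shows "\<exists>w. rel i w y"
proof -
  obtain f where f: "\<And>w. rel i w (f w)"
    using ex_rel_right by metis
  have "inj f"
    by (metis assms f injI rel_unique_left)
  then have "surj f" by (simp add: finite_UNIV_inj_surj)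
  then show ?thesis using f by (metis surjD)
qed

text \<open>The sign function \<open>F\<close>. For \<open>coprime i n\<close> the relation is a
  bijection, so the description picks out the unique \<open>w\<close>.\<close>

definition ind :: "nat \<Rightarrow> 'a \<Rightarrow> real" where
  "ind i y = chi (let w = (THE w. rel i w y) in w * fr i w)"

lemma ind_eq:
  assumes "coprime i n" "rel i w y"
  shows "ind i y = chi (w * fr i w)"
proof -
  have "(THE w. rel i w y) = w"
    using assms rel_unique_left by blast
  then show ?thesis by (simp add: ind_def)
qed

lemma ind_cases: "ind i y = 1 \<or> ind i y = - 1"
  by (simp add: ind_def chi_cases)

lemma sum_ind:
  assumes "coprime i n"
  shows "(\<Sum>y\<in>UNIV. ind i y) = 0"
proof -
  obtain f where f: "\<And>w. rel i w (f w)"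
    using ex_rel_right by metis
  have "bij f"
    using f rel_unique_left[OF assms]
    by (metis bijI finite finite_UNIV_inj_surj injI)
  then have "(\<Sum>y\<in>UNIV. ind i y) = (\<Sum>w\<in>UNIV. ind i (f w))"
    by (simp add: sum.reindex_bij_betw)
  also have "\<dots> = (\<Sum>w\<in>UNIV. chi (w * fr i w))"
    using ind_eq[OF assms f] by simp
  finally show ?thesis
    by (simp add: sum_gold[OF assms, of chi] sum_chi)
qed

lemma ind_fr:
  assumes "coprime i n"
  shows "ind i (fr k y) = ind i y"
proof -
  obtain w where w: "rel i w y" using ex_rel_left[OF assms] by blast
  have "rel i (fr k w) (fr k y)"
    unfolding rel_def
  proof
    have "fr k (fr i (fr i w) + y ^ 2 * fr i w + w) = fr k y"
      using w by (simp add: rel_def)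
    then show "fr i (fr i (fr k w)) + (fr k y) ^ 2 * fr i (fr k w) + fr k w = fr k y"
      by (simp add: fr_commute[of k i])
    have "chi (fr k (y * fr i w)) = chi (fr k (w * fr i w))"
      using w by (simp only: rel_def chi_fr)
    then show "chi (fr k y * fr i (fr k w)) = chi (fr k w * fr i (fr k w))"
      by (simp only: fr_mult fr_commute[of k i])
  qed
  then have "ind i (fr k y) = chi (fr k (w * fr i w))"
    by (simp add: ind_eq[OF assms] fr_commute[of k i] del: chi_fr)
  then show ?thesis
    using w by (simp only: ind_eq[OF assms] chi_fr)
qed

text \<open>Among the solutions \<open>w\<close> of the affine equation the two characters agree
  only at the one with \<open>rel i w y\<close>; everywhere else they are opposite and
  cancel.\<close>

lemma sum_rel:
  assumes "coprime i n"
  shows "(\<Sum>w | fr i (fr i w) + y ^ 2 * fr i w + w = y. chi (w * fr i w) + chi (y * fr i w)) = 2 * ind i y"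
proof -
  obtain w where w: "rel i w y" using ex_rel_left[OF assms] by blast
  let ?A = "{w. fr i (fr i w) + y ^ 2 * fr i w + w = y}"
  let ?f = "\<lambda>w. chi (w * fr i w) + chi (y * fr i w)"
  have "?f z = 0" if "z \<in> ?A" "z \<noteq> w" for z
  proof -
    have "chi (z * fr i z) \<noteq> chi (y * fr i z)"
      using that w rel_unique_left[OF assms] unfolding rel_def mem_Collect_eq by metis
    then show ?thesis
      using chi_cases[of "z * fr i z"] chi_cases[of "y * fr i z"] by auto
  qed
  then have "sum ?f ?A = sum ?f {w}"
    using w by (intro sum.mono_neutral_right) (auto simp only: rel_def finite)
  also have "\<dots> = 2 * ind i y"
    using conjunct2[OF w[unfolded rel_def]] ind_eq[OF assms w] by simp
  finally show ?thesis .
qed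

text \<open>Character 1 means \<open>w * fr i w = x ^ 2 + x\<close> for some \<open>x\<close>. Then
  \<open>fr i x + x\<close> solves the quadratic for \<open>y * fr i w\<close> and has character 1
  itself, so it is the selected root. In this form the complement of the block is
  recognised.\<close>

lemma ind_eq_1_iff:
  assumes "coprime i n"
  shows "ind i y = 1 \<longleftrightarrow> y = 0 \<or> (\<exists>w x. w \<noteq> 0 \<and> w * fr i w = x ^ 2 + x \<and> y * fr i w = fr i x + x)"
    (is "_ \<longleftrightarrow> y = 0 \<or> ?E")
proof -
  obtain w where w: "rel i w y" using ex_rel_left[OF assms] by blast
  show ?thesis
  proof
    assume "ind i y = 1"
    then have chi: "chi (w * fr i w) = 1" using ind_eq[OF assms w] by simp
    show "y = 0 \<or> ?E"
    proof (cases "w = 0")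
      case False
      obtain x where x: "x ^ 2 + x = w * fr i w" using chi by (rule chi_eq_1_obtain)
      have "rel i w ((fr i x + x) / fr i w)"
        using False by (simp add: rel_iff[OF False] chi_add chi_square square_add add_ac flip: x del: fr_mult)
      with w have "y = (fr i x + x) / fr i w" by (metis rel_unique_right)
      then have "y * fr i w = fr i x + x" using False by simp
      then show ?thesis using False x by metis
    qed (use w in simp)
  next
    assume "y = 0 \<or> ?E"
    then show "ind i y = 1"
    proof
      assume "y = 0"
      then have "rel i 0 y" by simp
      then show ?thesis using ind_eq[OF assms, of 0 y] by simp
    next
      assume ?E
      then obtain w x where wx: "w \<noteq> 0" "w * fr i w = x ^ 2 + x" "y * fr i w = fr i x + x" by blast
      then have "rel i w y"
        unfolding rel_iff[OF wx(1)] wx(2,3)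
        by (simp add: chi_add square_add chi_square add_ac)
      then have "ind i y = chi (x ^ 2 + x)" by (simp only: ind_eq[OF assms] wx)
      then show ?thesis by (simp add: chi_add chi_square)
    qed
  qed
qed

subsection \<open>The Walsh transform as a sum over norm tori\<close>

lemma sum_fr: "(\<Sum>x\<in>UNIV. f (fr k x)) = (\<Sum>x\<in>UNIV. f x)"
  using sum.reindex_bij_betw[OF bij_fr, of f] .

lemma sum_translate: "(\<Sum>x\<in>UNIV. f x) = (\<Sum>x\<in>UNIV. f (a + x))" for a :: 'a
  by (rule sum.reindex_bij_witness[of _ "\<lambda>x. a + x" "\<lambda>x. a + x"]) auto

text \<open>On the fibre \<open>N p = l ^ 2\<close> one has
  \<open>chi (l * y) = chi (N p * y ^ 2)\<close>; as squaring is a bijection, the fibres together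
  exhaust all \<open>p\<close>.\<close>

lemma sum_fibres_chi:
  fixes N :: "'b::finite \<Rightarrow> 'a"
  shows "(\<Sum>l\<in>UNIV. (\<Sum>p | N p = l ^ 2. h p) * chi (l * y)) = (\<Sum>p\<in>UNIV. h p * chi (N p * y ^ 2))"
proof -
  have "(\<Sum>l\<in>UNIV. (\<Sum>p | N p = l ^ 2. h p) * chi (l * y)) =
      (\<Sum>l\<in>UNIV. \<Sum>p | N p = l ^ 2. h p * chi (N p * y ^ 2))"
    unfolding sum_distrib_right
  proof (intro sum.cong refl)
    fix l p assume "p \<in> {p. N p = l ^ 2}"
    then have "chi (N p * y ^ 2) = chi ((l * y) ^ 2)"
      by (simp add: power_mult_distrib)
    then show "h p * chi (l * y) = h p * chi (N p * y ^ 2)"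
      by (simp only: chi_square)
  qed
  also have "\<dots> = (\<Sum>m\<in>UNIV. \<Sum>p | N p = m. h p * chi (N p * y ^ 2))"
    using sum_fr[of "\<lambda>m. \<Sum>p | N p = m. h p * chi (N p * y ^ 2)" 1] by (simp add: fr_1_eq)
  also have "\<dots> = (\<Sum>p\<in>UNIV. h p * chi (N p * y ^ 2))"
    using sum.group[of "UNIV :: 'b set" "UNIV :: 'a set" N "\<lambda>p. h p * chi (N p * y ^ 2)"] by simp
  finally show ?thesis .
qed

text \<open>The sums of \<open>\<chi>(Tr (a ^ (2 ^ i + 1)))\<close> over the elements \<open>a\<close> of norm \<open>l\<^sup>2\<close> of the split and (for odd \<open>i\<close>)
  the nonsplit quadratic algebra over \<open>GF(q)\<close>.\<close>

definition split_sum :: "nat \<Rightarrow> 'a \<Rightarrow> real" where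
  "split_sum i l = (\<Sum>p | fst p * snd p = l ^ 2. chi (fst p * fr i (fst p) + snd p * fr i (snd p)))"

definition nonsplit_sum :: "nat \<Rightarrow> 'a \<Rightarrow> real" where
  "nonsplit_sum i l = (\<Sum>p | fst p ^ 2 + fst p * snd p + snd p ^ 2 = l ^ 2.
     chi (fst p * fr i (snd p) + fr i (fst p) * snd p))"

lemma sum_chi_fr: "(\<Sum>z\<in>UNIV. chi (fr i z * c)) = (if c = 0 then 2 ^ n else 0)"
  using sum_fr[of "\<lambda>z. chi (z * c)" i] by (simp add: sum_chi_mult')

text \<open>Invariance of \<open>chi\<close> under Frobenius makes every factor linear in
  \<open>fr i z\<close>, so that summing over \<open>z\<close> forces the affine equation for
  \<open>w\<close>.\<close>

lemma chi_fr_collect: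
  "chi (z * fr i w) * chi (fr i z * w) * chi (z ^ 2 * y ^ 2) * chi (z * w * y ^ 2)
   = chi (fr i z * (fr i (fr i w) + (fr i y) ^ 2 * fr i w + w + fr i y))"
proof -
  have "chi (z * fr i w) = chi (fr i (z * fr i w))" by (simp only: chi_fr)
  moreover have "chi (z ^ 2 * y ^ 2) = chi (fr i (z * y))"
    by (simp only: chi_fr chi_square flip: power_mult_distrib)
  moreover have "chi (z * w * y ^ 2) = chi (fr i (z * w * y ^ 2))" by (simp only: chi_fr)
  ultimately show ?thesis
    by (simp add: distrib_left chi_add mult_ac)
qed

lemma sum_split_sum_chi:
  "(\<Sum>l\<in>UNIV. split_sum i l * chi (l * y)) =
   2 ^ n * (\<Sum>w | fr i (fr i w) + (fr i y) ^ 2 * fr i w + w = fr i y. chi (w * fr i w))"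
proof -
  let ?L = "\<lambda>w. fr i (fr i w) + (fr i y) ^ 2 * fr i w + w + fr i y"
  have "(\<Sum>l\<in>UNIV. split_sum i l * chi (l * y)) =
      (\<Sum>a\<in>UNIV. \<Sum>b\<in>UNIV. chi (a * fr i a + b * fr i b) * chi (a * b * y ^ 2))"
    unfolding split_sum_def sum_fibres_chi
    by (subst sum_pairs[of "\<lambda>a b. chi (a * fr i a + b * fr i b) * chi (a * b * y ^ 2)"]) simp
  \<comment> \<open>The substitution \<open>b = a + w\<close> cancels \<open>a * fr i a\<close>,
    leaving an argument of \<open>chi\<close> linear in \<open>a\<close> up to Frobenius.\<close>
  also have "\<dots> = (\<Sum>a\<in>UNIV. \<Sum>w\<in>UNIV.
      chi (a * fr i a + (a + w) * fr i (a + w)) * chi (a * (a + w) * y ^ 2))"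
    by (intro sum.cong refl sum_translate)
  also have "\<dots> = (\<Sum>a\<in>UNIV. \<Sum>w\<in>UNIV. chi (w * fr i w) * chi (fr i a * ?L w))"
  proof (intro sum.cong refl)
    fix a w
    have "a * fr i a + (a + w) * fr i (a + w) = w * fr i w + a * fr i w + fr i a * w"
      by (simp add: algebra_simps)
    moreover have "a * (a + w) * y ^ 2 = a ^ 2 * y ^ 2 + a * w * y ^ 2"
      by (simp add: algebra_simps power2_eq_square)
    ultimately show "chi (a * fr i a + (a + w) * fr i (a + w)) * chi (a * (a + w) * y ^ 2) =
        chi (w * fr i w) * chi (fr i a * ?L w)"
      by (simp only: chi_add mult.assoc flip: chi_fr_collect)
  qed
  also have "\<dots> = (\<Sum>w\<in>UNIV. \<Sum>a\<in>UNIV. chi (w * fr i w) * chi (fr i a * ?L w))"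
    by (rule sum.swap)
  also have "\<dots> = (\<Sum>w\<in>UNIV. chi (w * fr i w) * (if ?L w = 0 then 2 ^ n else 0))"
    by (simp only: sum_chi_fr flip: sum_distrib_left)
  also have "\<dots> = (\<Sum>w | ?L w = 0. chi (w * fr i w) * 2 ^ n)"
    by (rule sum.mono_neutral_cong_right) auto
  finally show ?thesis
    by (simp only: add_eq_0_iff_eq sum_distrib_left mult.commute)
qed

lemma sum_nonsplit_sum_chi:
  "(\<Sum>l\<in>UNIV. nonsplit_sum i l * chi (l * y)) =
   2 ^ n * (\<Sum>w | fr i (fr i w) + (fr i y) ^ 2 * fr i w + w = fr i y. chi (fr i y * fr i w))"
proof -
  let ?L = "\<lambda>w. fr i (fr i w) + (fr i y) ^ 2 * fr i w + w + fr i y"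
  have "(\<Sum>l\<in>UNIV. nonsplit_sum i l * chi (l * y)) =
      (\<Sum>z\<in>UNIV. \<Sum>w\<in>UNIV. chi (z * fr i w + fr i z * w) * chi ((z ^ 2 + z * w + w ^ 2) * y ^ 2))"
    unfolding nonsplit_sum_def sum_fibres_chi
    by (subst sum_pairs[of "\<lambda>z w. chi (z * fr i w + fr i z * w) * chi ((z ^ 2 + z * w + w ^ 2) * y ^ 2)"]) simp
  also have "\<dots> = (\<Sum>z\<in>UNIV. \<Sum>w\<in>UNIV. chi (fr i y * fr i w) * chi (fr i z * ?L w))"
  proof (intro sum.cong refl)
    fix z w
    have "chi (w ^ 2 * y ^ 2) = chi (fr i (y * w))"
      by (simp only: chi_fr chi_square mult.commute[of w y] flip: power_mult_distrib)
    then show "chi (z * fr i w + fr i z * w) * chi ((z ^ 2 + z * w + w ^ 2) * y ^ 2) =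
        chi (fr i y * fr i w) * chi (fr i z * ?L w)"
      unfolding chi_fr_collect[symmetric] chi_add distrib_right by (simp add: mult_ac)
  qed
  also have "\<dots> = (\<Sum>w\<in>UNIV. \<Sum>z\<in>UNIV. chi (fr i y * fr i w) * chi (fr i z * ?L w))"
    by (rule sum.swap)
  also have "\<dots> = (\<Sum>w\<in>UNIV. chi (fr i y * fr i w) * (if ?L w = 0 then 2 ^ n else 0))"
    by (simp only: sum_chi_fr flip: sum_distrib_left)
  also have "\<dots> = (\<Sum>w | ?L w = 0. chi (fr i y * fr i w) * 2 ^ n)"
    by (rule sum.mono_neutral_cong_right) auto
  finally show ?thesis
    by (simp only: add_eq_0_iff_eq sum_distrib_left mult.commute)
qed

lemma sum_split_nonsplit_chi:
  assumes "coprime i n"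
  shows "(\<Sum>l\<in>UNIV. (split_sum i l + nonsplit_sum i l) * chi (l * y)) = 2 * 2 ^ n * ind i y"
proof -
  have "(\<Sum>l\<in>UNIV. (split_sum i l + nonsplit_sum i l) * chi (l * y)) =
      2 ^ n * (2 * ind i (fr i y))"
    unfolding distrib_right sum.distrib sum_split_sum_chi sum_nonsplit_sum_chi
      sum_rel[OF assms, symmetric] by (simp only: distrib_left sum.distrib)
  then show ?thesis by (simp add: ind_fr[OF assms])
qed

definition walsh :: "nat \<Rightarrow> 'a \<Rightarrow> real" where
  "walsh i l = (\<Sum>y\<in>UNIV. ind i y * chi (l * y))"

text \<open>Fourier inversion of the preceding transform.\<close>

lemma walsh_eq_split_nonsplit:
  assumes "coprime i n"
  shows "2 * walsh i l = split_sum i l + nonsplit_sum i l"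
proof -
  let ?X = "\<lambda>m. split_sum i m + nonsplit_sum i m"
  have "2 * 2 ^ n * walsh i l = (\<Sum>y\<in>UNIV. (2 * 2 ^ n * ind i y) * chi (l * y))"
    by (simp add: walsh_def sum_distrib_left mult.assoc)
  also have "\<dots> = (\<Sum>y\<in>UNIV. \<Sum>m\<in>UNIV. ?X m * chi ((m + l) * y))"
    unfolding sum_split_nonsplit_chi[OF assms, symmetric] sum_distrib_right
    by (simp add: chi_add distrib_right mult.assoc)
  also have "\<dots> = (\<Sum>m\<in>UNIV. \<Sum>y\<in>UNIV. ?X m * chi ((m + l) * y))"
    by (rule sum.swap)
  also have "\<dots> = (\<Sum>m\<in>UNIV. ?X m * (if m = l then 2 ^ n else 0))"
    by (simp only: sum_chi_mult add_eq_0_iff_eq flip: sum_distrib_left)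
  also have "\<dots> = 2 ^ n * ?X l"
    by (simp add: if_distrib[of "\<lambda>x. _ * x"] cong: if_cong)
  finally show ?thesis by simp
qed

lemma walsh_zero: "coprime i n \<Longrightarrow> walsh i 0 = 0"
  by (simp add: walsh_def sum_ind)

end

subsection \<open>Comparison of the exponents\<close>

text \<open>\<open>Eis z w\<close> stands for \<open>z + w \<omega>\<close> with \<open>\<omega>\<^sup>2 = \<omega> + 1\<close>; over \<open>GF(q)\<close>, \<open>q\<close> an odd power of two, this is \<open>GF(q\<^sup>2)\<close>,
  and \<open>im\<close> is the trace to \<open>GF(q)\<close>.\<close>

datatype 'a eis = Eis (re: 'a) (im: 'a)

instantiation eis :: (comm_semiring_1) comm_monoid_mult
begin

definition one_eis :: "'a eis" where "1 = Eis 1 0"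

definition times_eis :: "'a eis \<Rightarrow> 'a eis \<Rightarrow> 'a eis" where
  "a * b = Eis (re a * re b + im a * im b) (re a * im b + im a * re b + im a * im b)"

instance
  by standard (simp_all add: one_eis_def times_eis_def algebra_simps)

end

context odd_binary_field
begin

text \<open>Squaring exchanges \<omega> and \<omega> + 1, so the parity of \<open>k\<close> decides
  the image of \<omega>. This is where odd \<open>i\<close> matters.\<close>

lemma eis_frob: "(Eis z w) ^ (2 ^ k) = Eis (fr k z + (if odd k then fr k w else 0)) (fr k w)"
proof (induction k)
  case (Suc k)
  have "(Eis z w) ^ (2 ^ Suc k) = ((Eis z w) ^ (2 ^ k)) ^ 2"
    by (simp add: mult.commute flip: power_mult)
  then show ?case
    unfolding Suc.IH by (auto simp: power2_eq_square times_eis_def fr_Suc algebra_simps)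
qed simp

definition nrm :: "'a eis \<Rightarrow> 'a" where
  "nrm a = re a ^ 2 + re a * im a + im a ^ 2"

lemma nrm_mult: "nrm (a * b) = nrm a * nrm b"
  by (simp add: nrm_def times_eis_def algebra_simps power2_eq_square)

text \<open>The witness is the conjugate of \<open>a\<close>, obtained by replacing \<omega> with
  \<omega> + 1.\<close>

lemma nrm_inverse: "nrm a = 1 \<Longrightarrow> \<exists>b. nrm b = 1 \<and> a * b = 1"
  by (rule exI[of _ "Eis (re a + im a) (im a)"])
     (simp add: nrm_def times_eis_def one_eis_def algebra_simps power2_eq_square)

lemma im_power_frob:
  "odd i \<Longrightarrow> im ((Eis z w) ^ (2 ^ i + 1)) = z * fr i w + fr i z * w"
  by (simp add: eis_frob times_eis_def algebra_simps)

lemma UNIV_eis: "(UNIV :: 'a eis set) = (\<lambda>p. Eis (fst p) (snd p)) ` UNIV"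
  by (auto simp: image_iff) (metis eis.exhaust)

lemma finite_eis: "finite (A :: 'a eis set)"
  by (rule finite_subset[OF subset_UNIV]) (simp add: UNIV_eis)

text \<open>For odd \<open>i\<close> the exponent 3 divides \<open>2 ^ i + 1\<close>. Conversely,
  with \<open>j\<close> odd and inverse to \<open>i\<close> modulo \<open>n\<close>,
  \<open>2 ^ i + 1\<close> divides \<open>2 ^ (i * j) + 1\<close>, which acts as the exponent
  3.\<close>

lemma sum_nrm_1_power:
  fixes f :: "'a eis \<Rightarrow> real"
  assumes "odd i" "coprime i n"
  shows "(\<Sum>a | nrm a = 1. f (a ^ (2 ^ i + 1))) = (\<Sum>a | nrm a = 1. f (a ^ 3))"
proof -
  obtain e where e: "2 ^ i + 1 = 3 * (e::nat)"
    using plus_1_dvd_odd_power_plus_1[OF assms(1), of 2] by auto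
  obtain j0 where j0: "[i * j0 = 1] (mod n)"
    using cong_solve_coprime_nat[OF assms(2)] by auto
  \<comment> \<open>Since \<open>n\<close> is odd, adding it corrects the parity without changing
    the residue.\<close>
  define j where "j = (if odd j0 then j0 else j0 + n)"
  have j: "odd j" "[i * j = 1] (mod n)"
    using j0 odd_n by (auto simp: j_def cong_def distrib_left)
  obtain g where g: "(2 ^ i) ^ j + 1 = (2 ^ i + 1) * (g::nat)"
    using plus_1_dvd_odd_power_plus_1[OF j(1), of "2 ^ i"] by auto
  have pow: "a ^ 3 = a ^ ((2 ^ i + 1) * g)" for a :: "'a eis"
  proof (cases a)
    case (Eis z w)
    have "fr (i * j) x = fr (Suc 0) x" for x using fr_cong[OF j(2)] by simp
    then have "a ^ (2 ^ (i * j)) = a ^ (2 ^ 1)"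
      using assms(1) j(1) by (simp only: Eis eis_frob) simp
    then have "a ^ (2 ^ (i * j) + 1) = a ^ 3"
      by (simp add: power_add power2_eq_square power3_eq_cube mult.assoc)
    then show ?thesis unfolding g[symmetric] by (simp only: power_mult[symmetric])
  qed
  show ?thesis
  proof (rule sum_power_cong[where e = e and g = g])
    show "a ^ (2 ^ i + 1) = a ^ (3 * e)" for a :: "'a eis"
      by (simp only: e)
    show "a ^ 3 = a ^ ((2 ^ i + 1) * g)" for a :: "'a eis"
      by (rule pow)
  qed (use nrm_inverse in \<open>auto simp: finite_eis nrm_mult\<close>)
qed

text \<open>Dividing by \<open>l\<close> moves the sum to norm one, where the exponents
  \<open>2 ^ i + 1\<close> and 3 are interchangeable.\<close>

lemma nonsplit_sum_eq:
  assumes "odd i" "coprime i n" "l \<noteq> 0"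
  shows "nonsplit_sum i l = (\<Sum>a | nrm a = 1. chi (l * fr i l * im (a ^ 3)))"
proof -
  have "nonsplit_sum i l = (\<Sum>a | nrm a = 1. chi (l * fr i l * im (a ^ (2 ^ i + 1))))"
    unfolding nonsplit_sum_def
  proof (rule sum.reindex_bij_witness[where
        i = "\<lambda>a. (l * re a, l * im a)" and j = "\<lambda>p. Eis (fst p / l) (snd p / l)"])
    fix a assume "a \<in> {a. nrm a = 1}"
    then have "l ^ 2 * (re a ^ 2 + re a * im a + im a ^ 2) = l ^ 2" by (simp add: nrm_def)
    then show "(l * re a, l * im a) \<in> {p. fst p ^ 2 + fst p * snd p + snd p ^ 2 = l ^ 2}"
      by (simp add: power2_eq_square algebra_simps)
  next
    fix p assume "p \<in> {p. fst p ^ 2 + fst p * snd p + snd p ^ 2 = l ^ 2}"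
    then have "(fst p ^ 2 + fst p * snd p + snd p ^ 2) / l ^ 2 = 1" using assms by simp
    then show "Eis (fst p / l) (snd p / l) \<in> {a. nrm a = 1}"
      by (simp add: nrm_def power2_eq_square add_divide_distrib)
  next
    fix p :: "'a \<times> 'a"
    have "l * fr i l * im (Eis (fst p / l) (snd p / l) ^ (2 ^ i + 1)) =
        l * fr i l * (fst p / l * (fr i (snd p) / fr i l) + fr i (fst p) / fr i l * (snd p / l))"
      by (simp only: im_power_frob[OF assms(1)] fr_divide)
    also have "\<dots> = fst p * fr i (snd p) + fr i (fst p) * snd p"
      using assms(3) by (simp add: field_simps)
    finally show "chi (l * fr i l * im (Eis (fst p / l) (snd p / l) ^ (2 ^ i + 1))) =
        chi (fst p * fr i (snd p) + fr i (fst p) * snd p)" by (rule arg_cong)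
  qed (use assms in auto)
  also have "\<dots> = (\<Sum>a | nrm a = 1. chi (l * fr i l * im (a ^ 3)))"
    by (rule sum_nrm_1_power[OF assms(1,2)])
  finally show ?thesis .
qed

text \<open>The pairs are \<open>(l * r, l / r)\<close>, and the Gold power permutes the nonzero
  \<open>r\<close>; so \<open>i\<close> survives only in \<open>l * fr i l\<close>.\<close>

lemma split_sum_eq:
  assumes "coprime i n" "l \<noteq> 0"
  shows "split_sum i l = (\<Sum>r | r \<noteq> 0. chi (l * fr i l * (r + 1 / r)))"
proof -
  have "split_sum i l = (\<Sum>r | r \<noteq> 0. chi (l * fr i l * (r * fr i r + 1 / (r * fr i r))))"
    unfolding split_sum_def
  proof (rule sum.reindex_bij_witness[where i = "\<lambda>r. (l * r, l / r)" and j = "\<lambda>p. fst p / l"])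
    fix p assume p: "p \<in> {p. fst p * snd p = l ^ 2}"
    then have "fst p \<noteq> 0" using assms(2) by auto
    then show "fst p / l \<in> {r. r \<noteq> 0}" using assms by simp
    have snd: "snd p = l ^ 2 / fst p"
      using p \<open>fst p \<noteq> 0\<close> by (simp add: field_simps)
    show "(l * (fst p / l), l / (fst p / l)) = p"
      using assms(2) by (simp add: prod_eq_iff snd power2_eq_square)
    have "l * fr i l * (fst p / l * fr i (fst p / l) + 1 / (fst p / l * fr i (fst p / l))) =
        fst p * fr i (fst p) + snd p * fr i (snd p)"
      using assms(2) \<open>fst p \<noteq> 0\<close> unfolding snd
      by (simp add: distrib_left power2_eq_square)
    then show "chi (l * fr i l * (fst p / l * fr i (fst p / l) + 1 / (fst p / l * fr i (fst p / l)))) =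
        chi (fst p * fr i (fst p) + snd p * fr i (snd p))" by simp
  qed (use assms in \<open>auto simp: power2_eq_square\<close>)
  also have "\<dots> = (\<Sum>r\<in>UNIV. (\<lambda>r. if r = 0 then 0 else chi (l * fr i l * (r + 1 / r))) (r * fr i r))"
    by (rule sum.mono_neutral_cong_left) auto
  also have "\<dots> = (\<Sum>r\<in>UNIV. (if r = 0 then 0 else chi (l * fr i l * (r + 1 / r))))"
    by (rule sum_gold[OF assms(1)])
  also have "\<dots> = (\<Sum>r | r \<noteq> 0. chi (l * fr i l * (r + 1 / r)))"
    by (rule sum.mono_neutral_cong_right) auto
  finally show ?thesis .
qed

lemma coprime_1_n: "coprime (Suc 0) n"
  by simp

text \<open>For exponent 2 the solution is \<open>w = y\<close>, as \<open>y ^ 4\<close>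
  cancels.\<close>

lemma ind_1: "ind (Suc 0) y = chi (y ^ 3)"
proof -
  have "rel (Suc 0) y y"
    by (simp add: rel_def fr_1_eq flip: power_add power_mult)
  then have "ind (Suc 0) y = chi (y * fr (Suc 0) y)"
    by (rule ind_eq[OF coprime_1_n])
  then show ?thesis by (simp add: fr_1_eq power2_eq_square power3_eq_cube mult.assoc)
qed

text \<open>Both torus sums depend on \<open>i\<close> and \<open>l\<close> only through
  \<open>l * fr i l\<close>. An \<open>m\<close> whose cube is this value replaces \<open>i\<close>
  by 1, where the transform is an explicit cubic sum.\<close>

lemma walsh_eq_cubic_sum:
  assumes "odd i" "coprime i n" "l \<noteq> 0"
  obtains m where "m \<noteq> 0" "m * fr (Suc 0) m = l * fr i l" "walsh i l = (\<Sum>y\<in>UNIV. chi (y ^ 3 + m * y))"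
proof -
  obtain m where m: "m * fr (Suc 0) m = l * fr i l"
    using bij_gold[OF coprime_1_n] by (metis bij_pointE)
  have m0: "m \<noteq> 0" using m assms(3) by auto
  have "2 * walsh i l = 2 * walsh (Suc 0) m"
    using assms m0 coprime_1_n
    by (simp add: walsh_eq_split_nonsplit nonsplit_sum_eq split_sum_eq flip: m)
  also have "walsh (Suc 0) m = (\<Sum>y\<in>UNIV. chi (y ^ 3 + m * y))"
    by (simp only: walsh_def ind_1 chi_add)
  finally show ?thesis using that m m0 by simp
qed

lemma walsh_eq:
  assumes "odd i" "coprime i n" "l \<noteq> 0"
  shows "walsh i l = (\<Sum>z\<in>UNIV. chi (l * fr i l * (z ^ 3 + z)))"
proof -
  obtain m where m0: "m \<noteq> 0" and m: "m * fr (Suc 0) m = l * fr i l"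
    and "walsh i l = (\<Sum>y\<in>UNIV. chi (y ^ 3 + m * y))"
    using walsh_eq_cubic_sum[OF assms] .
  note this(3)
  \<comment> \<open>Squaring and renaming \<open>y ^ 2\<close> turns \<open>m\<close> into
    \<open>m ^ 2\<close>; then \<open>y = m * z\<close> gives both terms the factor
    \<open>m ^ 3\<close>.\<close>
  also have "(\<Sum>y\<in>UNIV. chi (y ^ 3 + m * y)) = (\<Sum>y\<in>UNIV. chi ((y ^ 3 + m * y) ^ 2))"
    by (simp add: chi_square)
  also have "\<dots> = (\<Sum>y\<in>UNIV. chi ((fr 1 y) ^ 3 + m ^ 2 * fr 1 y))"
    by (simp add: square_add fr_1_eq power_mult_distrib flip: power_mult)
  also have "\<dots> = (\<Sum>y\<in>UNIV. chi (y ^ 3 + m ^ 2 * y))"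
    by (rule sum_fr)
  also have "\<dots> = (\<Sum>z\<in>UNIV. chi ((m * z) ^ 3 + m ^ 2 * (m * z)))"
    using m0 by (intro sum.reindex_bij_witness[of _ "\<lambda>z. m * z" "\<lambda>y. y / m"]) auto
  also have "\<dots> = (\<Sum>z\<in>UNIV. chi (l * fr i l * (z ^ 3 + z)))"
    unfolding m[symmetric] by (simp add: fr_1_eq algebra_simps power2_eq_square power3_eq_cube)
  finally show ?thesis .
qed

subsection \<open>Points on the cubic surface\<close>

lemma sum_scale:
  "s \<noteq> 0 \<Longrightarrow> (\<Sum>x\<in>UNIV. f (s * x)) = (\<Sum>x\<in>UNIV. f x)" for s :: 'a
  by (intro sum.reindex_bij_witness[of _ "\<lambda>x. x / s" "\<lambda>x. s * x"]) auto

lemma sum_of_bool_eq_1: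
  assumes "\<And>x. P x \<longleftrightarrow> x = (c::'a)"
  shows "(\<Sum>x\<in>UNIV. of_bool (P x)) = (1::real)"
  by (simp add: assms of_bool_def)

lemma cube_eq_gold: "x ^ 3 = x * fr (Suc 0) x"
  by (simp add: fr_1_eq power2_eq_square power3_eq_cube mult.assoc)

lemma cube_eq_iff: "x ^ 3 = y ^ 3 \<longleftrightarrow> x = (y::'a)"
  using gold_inj[OF coprime_1_n] unfolding cube_eq_gold by blast

lemma card_nonzero: "real (card {s::'a. s \<noteq> 0}) = 2 ^ n - 1"
proof -
  have "{s::'a. s \<noteq> 0} = UNIV - {0}" by auto
  then show ?thesis by (simp add: card_Diff_singleton card_field)
qed

lemma cube_root_unique:
  assumes "c \<noteq> 0"
  obtains r where "\<And>z. a + c * z ^ 3 = 0 \<longleftrightarrow> z = (r::'a)"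
proof -
  obtain r where r: "r ^ 3 = a / c"
    using bij_gold[OF coprime_1_n] unfolding cube_eq_gold by (metis bij_pointE)
  have "a + c * z ^ 3 = 0 \<longleftrightarrow> z = r" for z
  proof -
    have "a + c * z ^ 3 = 0 \<longleftrightarrow> r ^ 3 = z ^ 3"
      using assms by (simp add: add_eq_0_iff_eq r field_simps)
    also have "\<dots> \<longleftrightarrow> z = r"
      by (auto simp: cube_eq_iff)
    finally show ?thesis .
  qed
  then show ?thesis using that by blast
qed

lemma sum_of_bool_cube:
  assumes "c \<noteq> 0"
  shows "(\<Sum>z\<in>UNIV. of_bool (a + c * z ^ 3 = (0::'a))) = (1::real)"
proof -
  obtain r where "\<And>z. a + c * z ^ 3 = 0 \<longleftrightarrow> z = r"
    using cube_root_unique[OF assms, of a] by blast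
  then show ?thesis by (rule sum_of_bool_eq_1)
qed

text \<open>The count is 1 if neither coefficient vanishes, 0 if exactly one does and
  \<open>2 ^ n - 1\<close> if both do; the right side combines these cases into products that can be
  summed.\<close>

lemma sum_of_bool_nonzero_root:
  "(\<Sum>s\<in>UNIV. of_bool (s \<noteq> 0 \<and> s * C + Q = 0)) =
   1 - of_bool (C = 0) - of_bool (Q = 0) + 2 ^ n * (of_bool (C = 0) * of_bool (Q = (0::'a)) :: real)"
proof (cases "C = 0")
  case True
  have "(\<Sum>s\<in>UNIV. of_bool (s \<noteq> (0::'a))) = (2 ^ n - 1 :: real)"
    using card_nonzero by simp
  then show ?thesis using True by simp
next
  case False
  have *: "s * C + Q = 0 \<longleftrightarrow> s = Q / C" for s
    using False by (simp add: add_eq_0_iff_eq eq_divide_eq)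
  show ?thesis
  proof (cases "Q = 0")
    case True
    then show ?thesis using False by simp
  next
    case Q: False
    then have "(\<Sum>s\<in>UNIV. of_bool (s \<noteq> 0 \<and> s * C + Q = 0)) = (1::real)"
      using False by (intro sum_of_bool_eq_1[of _ "Q / C"]) (auto simp: *)
    then show ?thesis using False Q by simp
  qed
qed

text \<open>Seen from the double point the equation is \<open>C + Q = 0\<close> with a cubic form
  \<open>C\<close> and a quadratic form \<open>Q\<close>. With \<open>q = 2 ^ n\<close>, counting
  nonzero roots \<open>s\<close> of \<open>s * C + Q\<close> gives
  \<open>q ^ 3 - q ^ 2 - q ^ 2 + q * q\<close>, as \<open>C\<close> and \<open>Q\<close> each have
  \<open>q ^ 2\<close> zeros and share \<open>q\<close> of them.\<close>

lemma cubic_surface_count: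
  assumes cop: "coprime i n" and t: "t1 \<noteq> 0" "t2 \<noteq> 0" "t3 \<noteq> 0" "t1 + t2 + t3 = 0"
  shows "(\<Sum>x\<in>UNIV. \<Sum>y\<in>UNIV. \<Sum>z\<in>UNIV. of_bool (t1 * fr i t1 * (x ^ 3 + x) + t2 * fr i t2 * (y ^ 3 + y)
           + t3 * fr i t3 * (z ^ 3 + z) = 0)) = (2 ^ n * 2 ^ n :: real)"
proof -
  obtain p1 p2 where p: "p1 ^ 2 = t1" "p2 ^ 2 = t2"
    using bij_fr[of 1] by (metis bij_pointE fr_1_eq One_nat_def)
  define p3 where "p3 = p1 + p2"
  have p3: "p3 ^ 2 = t3"
    using t(4) by (simp add: p3_def square_add p add_eq_0_iff_eq)
  define u1 u2 u3 where "u1 = fr i p1" and "u2 = fr i p2" and "u3 = u1 + u2"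
  have u3: "u3 = fr i p3" by (simp add: u1_def u2_def u3_def p3_def)
  have p0: "p1 \<noteq> 0" "p2 \<noteq> 0" "p3 \<noteq> 0" using p p3 t by auto
  then have u0: "u1 \<noteq> 0" "u2 \<noteq> 0" "u3 \<noteq> 0" by (simp_all add: u1_def u2_def u3)
  define c1 c2 c3 where "c1 = (p1 * u1) ^ 2" and "c2 = (p2 * u2) ^ 2" and "c3 = (p3 * u3) ^ 2"
  have c: "t1 * fr i t1 = c1" "t2 * fr i t2 = c2" "t3 * fr i t3 = c3"
    by (simp_all add: c1_def c2_def c3_def u1_def u2_def u3 power_mult_distrib flip: p p3)
  have c0: "c1 \<noteq> 0" "c2 \<noteq> 0" "c3 \<noteq> 0" using p0 u0 by (simp_all add: c1_def c2_def c3_def)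
  \<comment> \<open>Otherwise \<open>p1 / p2\<close> is fixed by \<open>fr i\<close>, hence equal to
    1, and \<open>p3 = 0\<close>.\<close>
  have det: "p1 * u2 + p2 * u1 \<noteq> 0"
  proof
    assume "p1 * u2 + p2 * u1 = 0"
    then have "u1 / u2 = p1 / p2"
      using p0 u0 by (simp add: add_eq_0_iff_eq frac_eq_eq mult.commute)
    then have "fr i (p1 / p2) = p1 / p2"
      by (simp add: u1_def u2_def)
    then have "p1 / p2 = 1" using fr_fixed[OF cop, of "p1 / p2"] p0 by simp
    then show False using p0 by (simp add: p3_def)
  qed
  define C Q where "C x y z = c1 * x ^ 3 + c2 * y ^ 3 + c3 * z ^ 3"
    and "Q x y z = c1 * x ^ 2 + c2 * y ^ 2 + c3 * z ^ 2" for x y z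
  \<comment> \<open>In characteristic two \<open>Q\<close> is the square of a linear form, so its
    zero set is a plane, the graph of \<open>h\<close>.\<close>
  have Q: "Q x y z = (p1 * u1 * x + p2 * u2 * y + p3 * u3 * z) ^ 2" for x y z
    by (simp add: Q_def c1_def c2_def c3_def square_add power_mult_distrib)
  define d where "d = p3 * u3"
  have d0: "d \<noteq> 0" using p0 u0 by (simp add: d_def)
  define h where "h x y = (p1 * u1 * x + p2 * u2 * y) / d" for x y
  have Q0: "Q x y z = 0 \<longleftrightarrow> z = h x y" for x y z
    unfolding Q using d0 by (auto simp: add_eq_0_iff_eq h_def field_simps simp flip: d_def)
  have sumC: "(\<Sum>x\<in>UNIV. \<Sum>y\<in>UNIV. \<Sum>z\<in>UNIV. of_bool (C x y z = 0)) = (2 ^ n * 2 ^ n :: real)"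
  proof -
    have "(\<Sum>z\<in>UNIV. of_bool (C x y z = 0)) = (1::real)" for x y
      unfolding C_def by (rule sum_of_bool_cube[OF c0(3)])
    then show ?thesis by (simp add: card_field)
  qed
  have sumQ: "(\<Sum>x\<in>UNIV. \<Sum>y\<in>UNIV. \<Sum>z\<in>UNIV. of_bool (Q x y z = 0)) = (2 ^ n * 2 ^ n :: real)"
    by (simp add: Q0 sum_of_bool_eq_1 card_field)
  have sumCQ: "(\<Sum>x\<in>UNIV. \<Sum>y\<in>UNIV. \<Sum>z\<in>UNIV. of_bool (C x y z = 0) * of_bool (Q x y z = 0)) = (2 ^ n :: real)"
  proof -
    have "(\<Sum>z\<in>UNIV. of_bool (C x y z = 0) * of_bool (Q x y z = 0)) = (of_bool (C x y (h x y) = 0) :: real)" for x y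
      unfolding Q0 by (simp add: of_bool_def if_distrib[of "\<lambda>x. _ * x"] cong: if_cong)
    then have "(\<Sum>x\<in>UNIV. \<Sum>y\<in>UNIV. \<Sum>z\<in>UNIV. of_bool (C x y z = 0) * of_bool (Q x y z = 0)) =
        (\<Sum>x\<in>UNIV. \<Sum>y\<in>UNIV. (of_bool (C x y (h x y) = 0) :: real))" by simp
    also have "\<dots> = (\<Sum>q\<in>UNIV. of_bool (C (fst q) (snd q) (h (fst q) (snd q)) = 0))"
      by (rule sum_pairs[symmetric])
    \<comment> \<open>New coordinates on the plane, with basis vectors formed by the inverses of the
      \<open>p\<close> and of the \<open>u\<close>; \<open>det\<close> makes the change
      bijective.\<close>
    also have "\<dots> = (\<Sum>q\<in>UNIV. of_bool (C (fst q / p1 + snd q / u1) (fst q / p2 + snd q / u2)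
        (h (fst q / p1 + snd q / u1) (fst q / p2 + snd q / u2)) = 0))"
    proof -
      let ?T = "\<lambda>q. (fst q / p1 + snd q / u1, fst q / p2 + snd q / u2)"
      have "inj ?T"
      proof (rule injI, rule prod_eqI)
        fix q r assume "?T q = ?T r"
        then have e1: "fst q / p1 + snd q / u1 = fst r / p1 + snd r / u1"
          and e2: "fst q / p2 + snd q / u2 = fst r / p2 + snd r / u2" by auto
        define a b where "a = fst q + fst r" and "b = snd q + snd r"
        have "a / p1 + b / u1 = 0" "a / p2 + b / u2 = 0"
          using add_eq_add_swap[OF e1] add_eq_add_swap[OF e2]
          by (simp_all add: a_def b_def add_divide_distrib add_eq_0_iff_eq)
        then have A: "a * u1 + b * p1 = 0" "a * u2 + b * p2 = 0"
          using p0 u0 by (simp_all add: field_simps)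
        have "b * (p1 * u2 + p2 * u1) = u2 * (a * u1 + b * p1) + u1 * (a * u2 + b * p2)"
          by (simp add: algebra_simps)
        then have "b = 0" using A det by simp
        then have "a = 0" using A u0 by simp
        then show "fst q = fst r" by (simp add: a_def add_eq_0_iff_eq)
        show "snd q = snd r" using \<open>b = 0\<close> by (simp add: b_def add_eq_0_iff_eq)
      qed
      then have "bij ?T" by (simp add: bij_def finite_UNIV_inj_surj)
      from sum.reindex_bij_betw[OF this, of "\<lambda>q. of_bool (C (fst q) (snd q) (h (fst q) (snd q)) = 0)"]
      show ?thesis unfolding fst_conv snd_conv by (rule sym)
    qed
    also have "\<dots> = (\<Sum>\<xi>\<in>UNIV. \<Sum>\<eta>\<in>UNIV. of_bool (C (\<xi> / p1 + \<eta> / u1) (\<xi> / p2 + \<eta> / u2)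
        (h (\<xi> / p1 + \<eta> / u1) (\<xi> / p2 + \<eta> / u2)) = 0))"
      by (rule sum_pairs)
    also have "\<dots> = (\<Sum>\<xi>\<in>(UNIV::'a set). 1)"
    proof (rule sum.cong[OF refl])
      fix \<xi>
      define D where "D = p1 * u2 + p2 * u1"
      define \<beta> where "\<beta> = D ^ 2 / (u1 * u2 * u3)"
      have \<beta>: "\<beta> \<noteq> 0" using det u0 by (simp add: \<beta>_def D_def)
      have "C (\<xi> / p1 + \<eta> / u1) (\<xi> / p2 + \<eta> / u2) (h (\<xi> / p1 + \<eta> / u1) (\<xi> / p2 + \<eta> / u2))
          = \<xi> ^ 3 * (D ^ 2 / (p1 * p2 * p3)) + \<beta> * \<eta> ^ 3" for \<eta>
      proof -
        have "h (\<xi> / p1 + \<eta> / u1) (\<xi> / p2 + \<eta> / u2) = (\<xi> * u1 + \<eta> * p1 + (\<xi> * u2 + \<eta> * p2)) / d"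
          using p0 u0 by (simp add: h_def distrib_left mult.commute)
        also have "\<dots> = (\<xi> * u3 + \<eta> * p3) / (p3 * u3)"
          by (simp add: d_def u3_def p3_def distrib_left add_ac)
        also have "\<dots> = \<xi> / p3 + \<eta> / u3"
          using p0 u0 by (simp add: add_divide_distrib)
        finally have h: "h (\<xi> / p1 + \<eta> / u1) (\<xi> / p2 + \<eta> / u2) = \<xi> / p3 + \<eta> / u3" .
        have expand: "(p * u) ^ 2 * (\<xi> / p + \<eta> / u) ^ 3 =
            \<xi> ^ 3 * (u ^ 2 / p) + \<xi> ^ 2 * \<eta> * u + \<xi> * \<eta> ^ 2 * p + \<eta> ^ 3 * (p ^ 2 / u)"
          if "p \<noteq> 0" "u \<noteq> 0" for p u
        proof -
          have cube: "(a + b) ^ 3 = a ^ 3 + a ^ 2 * b + a * b ^ 2 + b ^ 3" for a b :: 'a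
            by (simp add: power2_eq_square power3_eq_cube algebra_simps)
          show ?thesis unfolding cube using that
            by (simp add: distrib_left power_divide power2_eq_square power3_eq_cube mult_ac)
        qed
        have norm: "a1 ^ 2 / b1 + a2 ^ 2 / b2 + (a1 + a2) ^ 2 / (b1 + b2) =
            (b1 * a2 + b2 * a1) ^ 2 / (b1 * b2 * (b1 + b2))"
          if "b1 \<noteq> 0" "b2 \<noteq> 0" "b1 + b2 \<noteq> 0" for a1 a2 b1 b2 :: 'a
        proof -
          have "(a1 ^ 2 / b1 + a2 ^ 2 / b2 + (a1 + a2) ^ 2 / (b1 + b2)) * (b1 * b2 * (b1 + b2)) =
            a1 ^ 2 * (b2 * (b1 + b2)) + a2 ^ 2 * (b1 * (b1 + b2)) + (a1 + a2) ^ 2 * (b1 * b2)"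
            unfolding distrib_right[of _ _ "b1 * b2 * (b1 + b2)"] using that by simp
          also have "\<dots> = (b1 * a2 + b2 * a1) ^ 2"
            by (simp add: power2_eq_square algebra_simps)
          finally show ?thesis using that by (simp add: eq_divide_eq)
        qed
        have "C (\<xi> / p1 + \<eta> / u1) (\<xi> / p2 + \<eta> / u2) (\<xi> / p3 + \<eta> / u3) =
            \<xi> ^ 3 * (u1 ^ 2 / p1 + u2 ^ 2 / p2 + u3 ^ 2 / p3) + \<xi> ^ 2 * \<eta> * (u1 + u2 + u3)
            + \<xi> * \<eta> ^ 2 * (p1 + p2 + p3) + \<eta> ^ 3 * (p1 ^ 2 / u1 + p2 ^ 2 / u2 + p3 ^ 2 / u3)"
          unfolding C_def c1_def c2_def c3_def
          by (simp only: expand p0 u0 not_False_eq_True) (simp only: distrib_left add_ac)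
        \<comment> \<open>The mixed terms disappear because \<open>u1 + u2 + u3\<close> and
          \<open>p1 + p2 + p3\<close> are 0.\<close>
        also have "\<dots> = \<xi> ^ 3 * (u1 ^ 2 / p1 + u2 ^ 2 / p2 + u3 ^ 2 / p3)
            + \<eta> ^ 3 * (p1 ^ 2 / u1 + p2 ^ 2 / u2 + p3 ^ 2 / u3)"
          by (simp add: u3_def p3_def)
        also have "u1 ^ 2 / p1 + u2 ^ 2 / p2 + u3 ^ 2 / p3 = D ^ 2 / (p1 * p2 * p3)"
          using norm[of p1 p2 u1 u2] p0 by (simp add: u3_def p3_def D_def)
        also have "p1 ^ 2 / u1 + p2 ^ 2 / u2 + p3 ^ 2 / u3 = \<beta>"
          using norm[of u1 u2 p1 p2] u0 by (simp add: u3_def p3_def D_def \<beta>_def add.commute mult.commute)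
        finally show ?thesis by (simp only: h mult.commute)
      qed
      then show "(\<Sum>\<eta>\<in>UNIV. of_bool (C (\<xi> / p1 + \<eta> / u1) (\<xi> / p2 + \<eta> / u2)
        (h (\<xi> / p1 + \<eta> / u1) (\<xi> / p2 + \<eta> / u2)) = 0)) = (1::real)"
        by (simp only: sum_of_bool_cube[OF \<beta>])
    qed
    finally show ?thesis by (simp add: card_field)
  qed
  define M where "M = (\<Sum>x\<in>UNIV. \<Sum>y\<in>UNIV. \<Sum>z\<in>UNIV. of_bool (C x y z + Q x y z = 0) :: real)"
  have "(2 ^ n - 1) * M = (\<Sum>s | s \<noteq> (0::'a). M)"
    by (simp add: card_nonzero)
  also have "\<dots> = (\<Sum>s | s \<noteq> 0. \<Sum>x\<in>UNIV. \<Sum>y\<in>UNIV. \<Sum>z\<in>UNIV. of_bool (s * C x y z + Q x y z = 0))"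
  proof (intro sum.cong refl)
    fix s :: 'a assume "s \<in> {s. s \<noteq> 0}"
    then have s: "s \<noteq> 0" by simp
    \<comment> \<open>By homogeneity every nonzero \<open>s\<close> gives the same count
      \<open>M\<close>.\<close>
    have "C (s * x) (s * y) (s * z) + Q (s * x) (s * y) (s * z) = s ^ 2 * (s * C x y z + Q x y z)" for x y z
      by (simp add: C_def Q_def algebra_simps power2_eq_square power3_eq_cube)
    then have *: "C (s * x) (s * y) (s * z) + Q (s * x) (s * y) (s * z) = 0 \<longleftrightarrow> s * C x y z + Q x y z = 0" for x y z
      using s by simp
    show "M = (\<Sum>x\<in>UNIV. \<Sum>y\<in>UNIV. \<Sum>z\<in>UNIV. of_bool (s * C x y z + Q x y z = 0))"
      unfolding M_def
      by (subst (1 2 3) sum_scale[OF s, symmetric]) (simp only: *)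
  qed
  also have "\<dots> = (\<Sum>s\<in>UNIV. \<Sum>x\<in>UNIV. \<Sum>y\<in>UNIV. \<Sum>z\<in>UNIV. of_bool (s \<noteq> 0 \<and> s * C x y z + Q x y z = 0))"
    by (rule sum.mono_neutral_cong_left) auto
  also have "\<dots> = (\<Sum>x\<in>UNIV. \<Sum>y\<in>UNIV. \<Sum>z\<in>UNIV. \<Sum>s\<in>UNIV. of_bool (s \<noteq> 0 \<and> s * C x y z + Q x y z = 0))"
    by (rule sum_swap_3)
  also have "\<dots> = (2 ^ n - 1) * (2 ^ n * 2 ^ n)"
    by (simp only: sum_of_bool_nonzero_root sum.distrib sum_subtractf sum_distrib_left[symmetric] sumC sumQ sumCQ)
       (simp add: card_field algebra_simps)
  moreover have "(1::real) < 2 ^ n" using n_pos by simp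
  ultimately have "M = 2 ^ n * 2 ^ n" by simp
  moreover have "(\<Sum>x\<in>UNIV. \<Sum>y\<in>UNIV. \<Sum>z\<in>UNIV. of_bool (c1 * (x ^ 3 + x) + c2 * (y ^ 3 + y)
      + c3 * (z ^ 3 + z) = 0)) = M"
  proof -
    have *: "(1 + x) ^ 3 + (1 + x) = x ^ 3 + x ^ 2" for x :: 'a
      by (simp add: power2_eq_square power3_eq_cube algebra_simps)
    have "c1 * ((1 + x) ^ 3 + (1 + x)) + c2 * ((1 + y) ^ 3 + (1 + y)) + c3 * ((1 + z) ^ 3 + (1 + z))
        = C x y z + Q x y z" for x y z
      unfolding * by (simp add: C_def Q_def distrib_left add_ac)
    then show ?thesis
      unfolding M_def by (subst (1 2 3) sum_translate[of _ 1]) simp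
  qed
  ultimately show ?thesis by (simp only: c)
qed

subsection \<open>Triple correlations\<close>

text \<open>The Gold power turns the sum over \<open>v\<close> into one over all multipliers
  \<open>m\<close> of \<open>\<Phi>\<close>. That counts the points of the cubic surface, and the
  result is exactly the term \<open>g 0\<close>.\<close>

lemma sum_walsh_triple:
  assumes "odd i" and cop: "coprime i n" and t: "t1 \<noteq> 0" "t2 \<noteq> 0" "t3 \<noteq> 0" "t1 + t2 + t3 = 0"
  shows "(\<Sum>v\<in>UNIV. walsh i (t1 * v) * walsh i (t2 * v) * walsh i (t3 * v)) = 0"
proof -
  define \<Phi> where "\<Phi> x y z = t1 * fr i t1 * (x ^ 3 + x) + t2 * fr i t2 * (y ^ 3 + y) + t3 * fr i t3 * (z ^ 3 + z)"
    for x y z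
  define g where "g m = (\<Sum>x\<in>UNIV. \<Sum>y\<in>UNIV. \<Sum>z\<in>UNIV. chi (m * \<Phi> x y z))" for m
  have g0: "g 0 = 2 ^ n * 2 ^ n * 2 ^ n"
    by (simp add: g_def card_field)
  \<comment> \<open>At \<open>v = 0\<close> the Walsh values vanish although the cubic sums do not,
    hence the correction.\<close>
  have "walsh i (t1 * v) * walsh i (t2 * v) * walsh i (t3 * v) = g (v * fr i v) - (if v = 0 then g 0 else 0)" for v
  proof (cases "v = 0")
    case True
    then show ?thesis by (simp add: walsh_zero[OF cop])
  next
    case False
    have "walsh i (t1 * v) * walsh i (t2 * v) * walsh i (t3 * v) =
      (\<Sum>x\<in>UNIV. \<Sum>y\<in>UNIV. \<Sum>z\<in>UNIV. chi (t1 * v * fr i (t1 * v) * (x ^ 3 + x)) *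
        chi (t2 * v * fr i (t2 * v) * (y ^ 3 + y)) * chi (t3 * v * fr i (t3 * v) * (z ^ 3 + z)))"
      using t False by (simp only: walsh_eq[OF assms(1) cop] mult_eq_0_iff prod_of_three_sums simp_thms)
    also have "\<dots> = g (v * fr i v)"
      unfolding g_def chi_add[symmetric]
      by (intro sum.cong refl arg_cong[of _ _ chi]) (simp add: \<Phi>_def algebra_simps)
    finally show ?thesis using False by simp
  qed
  then have "(\<Sum>v\<in>UNIV. walsh i (t1 * v) * walsh i (t2 * v) * walsh i (t3 * v)) =
      (\<Sum>v\<in>UNIV. g (v * fr i v)) - g 0"
    by (simp add: sum_subtractf)
  also have "(\<Sum>v\<in>UNIV. g (v * fr i v)) = (\<Sum>m\<in>UNIV. g m)"
    by (rule sum_gold[OF cop])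
  also have "\<dots> = (\<Sum>x\<in>UNIV. \<Sum>y\<in>UNIV. \<Sum>z\<in>UNIV. 2 ^ n * of_bool (\<Phi> x y z = 0))"
    unfolding g_def sum_swap_3 sum_chi_mult' of_bool_def by (simp add: if_distrib cong: if_cong)
  also have "\<dots> = 2 ^ n * (2 ^ n * 2 ^ n)"
    by (simp only: sum_distrib_left[symmetric] \<Phi>_def cubic_surface_count[OF cop t])
  finally show ?thesis by (simp add: g0)
qed

lemma sum_ind_triple:
  assumes "odd i" and cop: "coprime i n" and t: "t1 \<noteq> 0" "t2 \<noteq> 0" "t3 \<noteq> 0" "t1 + t2 + t3 = 0"
  shows "(\<Sum>x\<in>UNIV. \<Sum>y\<in>UNIV. ind i x * ind i y * ind i ((t1 * x + t2 * y) / t3)) = 0"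
proof -
  have "0 = (\<Sum>v\<in>UNIV. walsh i (t1 * v) * walsh i (t2 * v) * walsh i (t3 * v))"
    using sum_walsh_triple[OF assms] by simp
  also have "\<dots> = (\<Sum>v\<in>UNIV. \<Sum>x\<in>UNIV. \<Sum>y\<in>UNIV. \<Sum>z\<in>UNIV.
      ind i x * ind i y * ind i z * chi (v * (t1 * x + t2 * y + t3 * z)))"
    unfolding walsh_def prod_of_three_sums
    by (simp add: distrib_left chi_add mult_ac)
  also have "\<dots> = (\<Sum>x\<in>UNIV. \<Sum>y\<in>UNIV. \<Sum>z\<in>UNIV. \<Sum>v\<in>UNIV.
      ind i x * ind i y * ind i z * chi (v * (t1 * x + t2 * y + t3 * z)))"
    by (rule sum_swap_3)
  also have "\<dots> = (\<Sum>x\<in>UNIV. \<Sum>y\<in>UNIV. \<Sum>z\<in>UNIV.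
      ind i x * ind i y * ind i z * (if z = (t1 * x + t2 * y) / t3 then 2 ^ n else 0))"
  proof -
    have "t1 * x + t2 * y + t3 * z = 0 \<longleftrightarrow> z = (t1 * x + t2 * y) / t3" for x y z
      using t by (auto simp: add_eq_0_iff_eq eq_divide_eq mult.commute)
    then show ?thesis by (simp only: sum_chi_mult' flip: sum_distrib_left)
  qed
  also have "\<dots> = (\<Sum>x\<in>UNIV. \<Sum>y\<in>UNIV. ind i x * ind i y * ind i ((t1 * x + t2 * y) / t3) * 2 ^ n)"
    by (simp add: if_distrib[of "\<lambda>x. _ * x"] cong: if_cong)
  finally show ?thesis by (simp flip: sum_distrib_right)
qed

section \<open>Affine maps and their values at three points\<close>

lemma sum_affine_pairs:
  fixes f :: "'a \<Rightarrow> 'a \<Rightarrow> real"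
  assumes "x1 \<noteq> x2"
  shows "(\<Sum>a\<in>UNIV. \<Sum>b\<in>UNIV. f (a * x1 + b) (a * x2 + b)) = (\<Sum>x\<in>UNIV. \<Sum>y\<in>UNIV. f x y)"
proof -
  have "(\<Sum>q\<in>UNIV. f (fst q * x1 + snd q) (fst q * x2 + snd q)) = (\<Sum>q\<in>UNIV. f (fst q) (snd q))"
  proof -
    let ?T = "\<lambda>q. (fst q * x1 + snd q, fst q * x2 + snd q)"
    have "inj ?T"
    proof (rule injI, rule prod_eqI)
      fix q r assume "?T q = ?T r"
      then have e1: "fst q * x1 + snd q = fst r * x1 + snd r"
        and e2: "fst q * x2 + snd q = fst r * x2 + snd r" by auto
      have "(fst q + fst r) * (x1 + x2) =
          (fst q * x1 + snd q) + (fst r * x1 + snd r) + ((fst q * x2 + snd q) + (fst r * x2 + snd r))"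
        by (simp add: algebra_simps)
      then have "(fst q + fst r) * (x1 + x2) = 0" by (simp only: e1 e2 add_self)
      then show "fst q = fst r" using assms by (simp add: add_eq_0_iff_eq)
      then show "snd q = snd r" using e1 by simp
    qed
    then have "bij ?T" by (simp add: bij_def finite_UNIV_inj_surj)
    from sum.reindex_bij_betw[OF this, of "\<lambda>q. f (fst q) (snd q)"]
    show ?thesis by (simp only: fst_conv snd_conv)
  qed
  then show ?thesis
    using sum_pairs[of f] sum_pairs[of "\<lambda>a b. f (a * x1 + b) (a * x2 + b)"] by simp
qed

lemma sum_affine_triple:
  assumes "odd i" and cop: "coprime i n" and x: "x1 \<noteq> x2" "x1 \<noteq> x3" "x2 \<noteq> x3"
  shows "(\<Sum>a\<in>UNIV. \<Sum>b\<in>UNIV. ind i (a * x1 + b) * ind i (a * x2 + b) * ind i (a * x3 + b)) = 0"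
proof -
  \<comment> \<open>These are the coefficients of the affine dependency between three points of a
    line.\<close>
  define t1 t2 t3 where "t1 = x2 + x3" and "t2 = x1 + x3" and "t3 = x1 + x2"
  have t: "t1 \<noteq> 0" "t2 \<noteq> 0" "t3 \<noteq> 0" "t1 + t2 + t3 = 0"
    using x by (auto simp: t1_def t2_def t3_def add_eq_0_iff_eq add_ac)
  have "(t1 * (a * x1 + b) + t2 * (a * x2 + b)) / t3 = a * x3 + b" for a b
  proof -
    have "t1 * (a * x1 + b) + t2 * (a * x2 + b) = (a * x3 + b) * t3"
      by (simp add: t1_def t2_def t3_def algebra_simps)
    then show ?thesis using t by simp
  qed
  then show ?thesis
    using sum_affine_pairs[OF x(1), of "\<lambda>x y. ind i x * ind i y * ind i ((t1 * x + t2 * y) / t3)"]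
      sum_ind_triple[OF assms(1,2) t] by simp
qed

lemma sum_ind_translate: "coprime i n \<Longrightarrow> (\<Sum>b\<in>UNIV. ind i (a + b)) = 0"
  using sum_translate[of "ind i" a] sum_ind by simp

lemma ind_mult_self [simp]: "ind i y * ind i y = 1"
  using ind_cases[of i y] by auto

text \<open>Expand the three factors \<open>(1 - ind) / 2\<close>. Over all \<open>(a, b)\<close>
  every correlation vanishes, leaving \<open>2 ^ n * 2 ^ n / 8\<close>; the constant maps
  \<open>a = 0\<close> contribute \<open>2 ^ n / 2\<close> of this and are removed.\<close>

lemma card_affine_triples:
  assumes "odd i" and cop: "coprime i n" and x: "x1 \<noteq> x2" "x1 \<noteq> x3" "x2 \<noteq> x3"
  shows "real (card {q. fst q \<noteq> 0 \<and> (\<forall>x\<in>{x1, x2, x3}. ind i (fst q * x + snd q) = - 1)}) =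
    2 ^ n * (2 ^ n - 4) / 8"
proof -
  let ?I = "\<lambda>a b x. 1 - ind i (a * x + b)"
  have ind: "of_bool (ind i y = - 1) = (1 - ind i y) / 2" for y
    using ind_cases[of i y] by auto
  have pair: "(\<Sum>a\<in>UNIV. \<Sum>b\<in>UNIV. ind i (a * y + b) * ind i (a * z + b)) = 0" if "y \<noteq> z" for y z
    using sum_affine_pairs[OF that, of "\<lambda>x y. ind i x * ind i y"]
    by (simp add: sum_ind[OF cop] flip: sum_distrib_left)
  have "real (card {q. fst q \<noteq> 0 \<and> (\<forall>x\<in>{x1, x2, x3}. ind i (fst q * x + snd q) = - 1)}) =
      (\<Sum>q\<in>UNIV. of_bool (fst q \<noteq> 0 \<and> (\<forall>x\<in>{x1, x2, x3}. ind i (fst q * x + snd q) = - 1)))"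
    by simp
  also have "\<dots> = (\<Sum>a\<in>UNIV. \<Sum>b\<in>UNIV. of_bool (a \<noteq> 0 \<and> (\<forall>x\<in>{x1, x2, x3}. ind i (a * x + b) = - 1)))"
    by (rule sum_pairs[of "\<lambda>a b. of_bool (a \<noteq> 0 \<and> (\<forall>x\<in>{x1, x2, x3}. ind i (a * x + b) = - 1))"])
  also have "\<dots> = (\<Sum>a\<in>UNIV. of_bool (a \<noteq> 0) * ((\<Sum>b\<in>UNIV. ?I a b x1 * ?I a b x2 * ?I a b x3) / 8))"
    by (simp add: of_bool_conj ind sum_distrib_left sum_divide_distrib mult.assoc del: sum_of_bool_eq sum_mult_of_bool_eq sum_of_bool_mult_eq)
  also have "\<dots> = (\<Sum>a\<in>UNIV. (\<Sum>b\<in>UNIV. ?I a b x1 * ?I a b x2 * ?I a b x3) / 8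
       - (if a = 0 then 4 * 2 ^ n / 8 else 0))"
  proof (rule sum.cong[OF refl])
    fix a :: 'a
    have cube: "(1 - u) * (1 - u) * (1 - u) = 4 - 4 * u" if "u * u = 1" for u :: real
    proof -
      have "(1 - u) * (1 - u) * (1 - u) = 1 - 3 * u + 3 * (u * u) - (u * u) * u" by (simp add: algebra_simps)
      then show ?thesis using that by simp
    qed
    have "(\<Sum>b\<in>UNIV. ?I 0 b x1 * ?I 0 b x2 * ?I 0 b x3) = 4 * 2 ^ n"
      by (simp add: cube sum_subtractf card_field sum_ind[OF cop] flip: sum_distrib_left)
    then show "of_bool (a \<noteq> 0) * ((\<Sum>b\<in>UNIV. ?I a b x1 * ?I a b x2 * ?I a b x3) / 8) =
        (\<Sum>b\<in>UNIV. ?I a b x1 * ?I a b x2 * ?I a b x3) / 8 - (if a = 0 then 4 * 2 ^ n / 8 else 0)"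
      by auto
  qed
  also have "\<dots> = (\<Sum>a\<in>UNIV. \<Sum>b\<in>UNIV. ?I a b x1 * ?I a b x2 * ?I a b x3) / 8 - 4 * 2 ^ n / 8"
    by (simp add: sum_subtractf flip: sum_divide_distrib)
  also have "(\<Sum>a\<in>UNIV. \<Sum>b\<in>UNIV. ?I a b x1 * ?I a b x2 * ?I a b x3) =
      (\<Sum>a\<in>UNIV. \<Sum>b\<in>UNIV. 1 - ind i (a * x1 + b) - ind i (a * x2 + b) - ind i (a * x3 + b)
        + ind i (a * x1 + b) * ind i (a * x2 + b) + ind i (a * x1 + b) * ind i (a * x3 + b)
        + ind i (a * x2 + b) * ind i (a * x3 + b)
        - ind i (a * x1 + b) * ind i (a * x2 + b) * ind i (a * x3 + b))"
    by (intro sum.cong refl) (simp add: algebra_simps)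
  also have "\<dots> = 2 ^ n * 2 ^ n"
    using x by (simp add: sum.distrib sum_subtractf pair sum_affine_triple[OF assms] sum_ind_translate[OF cop] card_field)
  finally show ?thesis by (simp add: field_simps)
qed

section \<open>Size of the Walsh transform and absence of periods\<close>

lemma sum_chi_cubic_square_le: "(\<Sum>y\<in>UNIV. chi (y ^ 3 + m * y)) ^ 2 \<le> 2 * 2 ^ n"
proof -
  have "(\<Sum>y\<in>UNIV. chi (y ^ 3 + m * y)) ^ 2 =
      (\<Sum>y\<in>UNIV. \<Sum>w\<in>UNIV. chi (y ^ 3 + m * y) * chi (w ^ 3 + m * w))"
    by (simp add: power2_eq_square sum_product)
  also have "\<dots> = (\<Sum>y\<in>UNIV. \<Sum>w\<in>UNIV. chi (y ^ 3 + m * y) * chi ((y + w) ^ 3 + m * (y + w)))"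
    by (intro sum.cong refl sum_translate)
  also have "\<dots> = (\<Sum>y\<in>UNIV. \<Sum>w\<in>UNIV. chi (w ^ 3 + m * w) * chi (fr 1 y * (w + w ^ 4)))"
  proof (intro sum.cong refl)
    fix y w
    have "y ^ 3 + m * y + ((y + w) ^ 3 + m * (y + w)) = w ^ 3 + m * w + y ^ 2 * w + y * w ^ 2"
      by (simp add: algebra_simps power2_eq_square power3_eq_cube)
    then have "chi (y ^ 3 + m * y) * chi ((y + w) ^ 3 + m * (y + w)) =
        chi (w ^ 3 + m * w) * chi (y ^ 2 * w) * chi (y * w ^ 2)"
      by (simp only: chi_add[symmetric])
    also have "chi (y * w ^ 2) = chi ((y * w ^ 2) ^ 2)" by (simp only: chi_square)
    also have "(y * w ^ 2) ^ 2 = y ^ 2 * w ^ 4" by (simp add: power_mult_distrib flip: power_mult)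
    finally show "chi (y ^ 3 + m * y) * chi ((y + w) ^ 3 + m * (y + w)) =
        chi (w ^ 3 + m * w) * chi (fr 1 y * (w + w ^ 4))"
      by (simp add: fr_1_eq distrib_left chi_add)
  qed
  also have "\<dots> = (\<Sum>w\<in>UNIV. \<Sum>y\<in>UNIV. chi (w ^ 3 + m * w) * chi (fr 1 y * (w + w ^ 4)))"
    by (rule sum.swap)
  also have "\<dots> = (\<Sum>w\<in>UNIV. chi (w ^ 3 + m * w) * (if w + w ^ 4 = 0 then 2 ^ n else 0))"
    by (simp only: sum_chi_fr flip: sum_distrib_left)
  \<comment> \<open>Cubing is injective, so 1 is the only cube root of unity and just two shifts
    \<open>w\<close> contribute.\<close>
  also have "\<dots> = (\<Sum>w\<in>{0, 1}. chi (w ^ 3 + m * w) * (if w + w ^ 4 = 0 then 2 ^ n else 0))"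
  proof (rule sum.mono_neutral_right)
    show "\<forall>w\<in>UNIV - {0, 1}. chi (w ^ 3 + m * w) * (if w + w ^ 4 = 0 then 2 ^ n else 0) = 0"
    proof
      fix w assume w: "w \<in> UNIV - {0, 1::'a}"
      have "w + w ^ 4 = w * (1 + w ^ 3)" by (simp add: algebra_simps eval_nat_numeral)
      moreover have "w ^ 3 \<noteq> 1" using w cube_eq_iff[of w 1] by simp
      ultimately have "w + w ^ 4 \<noteq> 0" using w by (auto simp: add_eq_0_iff_eq)
      then show "chi (w ^ 3 + m * w) * (if w + w ^ 4 = 0 then 2 ^ n else 0) = 0" by simp
    qed
  qed auto
  also have "\<dots> = (1 + chi (1 + m)) * 2 ^ n"
    by (simp add: algebra_simps)
  also have "\<dots> \<le> 2 * 2 ^ n"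
    using chi_cases[of "1 + m"] by auto
  finally show ?thesis .
qed

lemma walsh_square_le:
  assumes "odd i" "coprime i n"
  shows "walsh i l ^ 2 \<le> 2 * 2 ^ n"
proof (cases "l = 0")
  case True
  then show ?thesis using walsh_zero[OF assms(2)] by simp
next
  case False
  then show ?thesis
    using walsh_eq_cubic_sum[OF assms] sum_chi_cubic_square_le by metis
qed

lemma sum_walsh_square: "(\<Sum>l\<in>UNIV. walsh i l ^ 2) = 2 ^ n * 2 ^ n"
proof -
  have "(\<Sum>l\<in>UNIV. walsh i l ^ 2) = (\<Sum>l\<in>UNIV. \<Sum>y\<in>UNIV. \<Sum>z\<in>UNIV. ind i y * ind i z * chi (l * (y + z)))"
    by (simp add: walsh_def power2_eq_square sum_product distrib_left chi_add mult_ac)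
  also have "\<dots> = (\<Sum>y\<in>UNIV. \<Sum>l\<in>UNIV. \<Sum>z\<in>UNIV. ind i y * ind i z * chi (l * (y + z)))"
    by (rule sum.swap)
  also have "\<dots> = (\<Sum>y\<in>UNIV. \<Sum>z\<in>UNIV. \<Sum>l\<in>UNIV. ind i y * ind i z * chi (l * (y + z)))"
    by (intro sum.cong refl sum.swap)
  also have "\<dots> = (\<Sum>y\<in>UNIV. \<Sum>z\<in>UNIV. ind i y * ind i z * (if y = z then 2 ^ n else 0))"
    by (simp only: sum_chi_mult' add_eq_0_iff_eq flip: sum_distrib_left)
  also have "\<dots> = 2 ^ n * 2 ^ n"
    by (simp add: if_distrib[of "\<lambda>x. _ * x"] card_field cong: if_cong)
  finally show ?thesis .
qed

lemma ind_no_period: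
  assumes "odd i" and cop: "coprime i n" and per: "\<And>y. ind i (b + y) = ind i y"
  shows "b = 0"
proof (rule ccontr)
  assume b: "b \<noteq> 0"
  \<comment> \<open>A period kills the transform wherever \<open>chi (l * b) = - 1\<close>. The
    extra zero at \<open>l = 0\<close> is what makes the total fall strictly short of Parseval's
    value.\<close>
  have le: "walsh i l ^ 2 \<le> 2 ^ n * (1 + chi (l * b)) - (if l = 0 then 2 * 2 ^ n else 0)" for l
  proof (cases "l = 0")
    case True
    then show ?thesis using walsh_zero[OF cop] by simp
  next
    case False
    have "walsh i l = (\<Sum>y\<in>UNIV. ind i (b + y) * chi (l * (b + y)))"
      unfolding walsh_def by (rule sum_translate)
    also have "\<dots> = chi (l * b) * walsh i l"
      by (simp add: walsh_def per distrib_left chi_add sum_distrib_left mult_ac)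
    finally have "walsh i l = chi (l * b) * walsh i l" .
    then show ?thesis
      using chi_cases[of "l * b"] walsh_square_le[OF assms(1,2), of l] False by auto
  qed
  have "(2::real) ^ n * 2 ^ n \<le> (\<Sum>l\<in>UNIV. 2 ^ n * (1 + chi (l * b)) - (if l = 0 then 2 * 2 ^ n else 0))"
    unfolding sum_walsh_square[of i, symmetric] by (rule sum_mono) (rule le)
  also have "\<dots> = 2 ^ n * 2 ^ n - 2 * 2 ^ n"
    using b by (simp add: sum_subtractf sum.distrib distrib_left card_field sum_chi_mult' flip: sum_distrib_left)
  finally have "(2::real) ^ n \<le> 0" by simp
  moreover have "(0::real) < 2 ^ n" by simp
  ultimately show False by linarith
qed

subsection \<open>The stabiliser of the block and the design\<close>

lemma card_ind_neg:
  assumes "coprime i n"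
  shows "2 * card {y. ind i y = - 1} = 2 ^ n"
proof -
  have "(\<Sum>y\<in>UNIV. of_bool (ind i y = - 1)) = (\<Sum>y\<in>UNIV. (1 - ind i y) / 2)"
    using ind_cases[of i] by (intro sum.cong refl) force
  also have "\<dots> = 2 ^ n / 2"
    by (simp add: sum_subtractf sum_ind[OF assms] card_field flip: sum_divide_distrib)
  finally have "real (2 * card {y. ind i y = - 1}) = real (2 ^ n)" by simp
  then show ?thesis by (simp only: of_nat_eq_iff)
qed

text \<open>If \<open>a \<noteq> 1\<close>, the map has a fixed point; translated there, the block
  is invariant under scaling by \<open>a\<close>. So \<open>a ^ k = 1\<close>, where
  \<open>k\<close> is the number of its nonzero elements, either \<open>2 ^ n / 2\<close> or one
  less. Together with \<open>a ^ (2 ^ n) = a\<close> this forces \<open>a = 1\<close>.\<close>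

lemma ind_stabilizer_scale:
  assumes cop: "coprime i n" and a: "a \<noteq> 0"
    and B: "(\<lambda>x. a * x + b) ` {y. ind i y = - 1} = {y. ind i y = - 1}"
  shows "a = 1"
proof (rule ccontr)
  assume "a \<noteq> 1"
  then have a1: "1 + a \<noteq> 0" by (auto simp: add_eq_0_iff_eq)
  let ?B = "{y. ind i y = - 1}"
  define c where "c = b / (1 + a)"
  have "c * (1 + a) = b" using a1 by (simp add: c_def)
  then have c: "a * x + b + c = a * (x + c)" for x
    by (auto simp: algebra_simps)
  define A where "A = (\<lambda>x. x + c) ` ?B"
  have "(\<lambda>x. a * x) ` A = (\<lambda>x. x + c) ` (\<lambda>x. a * x + b) ` ?B"
    by (simp only: A_def image_image c)
  then have aA: "(\<lambda>x. a * x) ` A = A" by (simp only: B A_def)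
  have "card A = card ?B"
    unfolding A_def by (rule card_image) (simp add: inj_on_def)
  then have cardA: "2 * card A = 2 ^ n" using card_ind_neg[OF cop] by simp
  have pow: "a ^ (2 * card A) = a"
    by (simp only: cardA power_q)
  show False
  proof (cases "0 \<in> A")
    case False
    from power_card_eq_1_if_scale_invariant[OF aA False a] have "a ^ (2 * card A) = 1"
      by (simp add: mult.commute[of 2] power_mult)
    then show False using pow \<open>a \<noteq> 1\<close> by simp
  next
    case True
    have "(\<lambda>x. a * x) ` (A - {0}) = (\<lambda>x. a * x) ` A - (\<lambda>x. a * x) ` {0}"
      using a by (intro image_set_diff) (simp add: inj_def)
    then have "(\<lambda>x. a * x) ` (A - {0}) = A - {0}" by (simp add: aA)
    from power_card_eq_1_if_scale_invariant[OF this _ a] have "a ^ card (A - {0}) = 1" by simp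
    moreover have "card A = Suc (card (A - {0}))"
      using True by (rule card.remove[rotated]) simp
    ultimately have "a ^ card A = a" by simp
    then have "a ^ (2 * card A) = a ^ 2"
      by (simp add: mult.commute[of 2] power_mult)
    then show False using pow a \<open>a \<noteq> 1\<close> by (simp add: power2_eq_square)
  qed
qed

lemma inj_on_affine_images:
  assumes "odd i" and cop: "coprime i n"
  shows "inj_on (\<lambda>q. (\<lambda>x. fst q * x + snd q) ` {y. ind i y = - 1}) {q. fst q \<noteq> 0}"
proof (rule inj_onI)
  fix q r :: "'a \<times> 'a"
  let ?B = "{y. ind i y = - 1}"
  assume "q \<in> {q. fst q \<noteq> 0}" "r \<in> {q. fst q \<noteq> 0}"
    and eq: "(\<lambda>x. fst q * x + snd q) ` ?B = (\<lambda>x. fst r * x + snd r) ` ?B"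
  then have q: "fst q \<noteq> 0" and r: "fst r \<noteq> 0" by auto
  define a b where "a = fst q / fst r" and "b = (snd q + snd r) / fst r"
  have "(\<lambda>x. a * x + b) ` ?B = (\<lambda>y. (y + snd r) / fst r) ` (\<lambda>x. fst q * x + snd q) ` ?B"
    by (simp add: image_image a_def b_def add_divide_distrib add.assoc)
  also have "\<dots> = ?B"
    using r by (simp add: eq image_image add.assoc)
  finally have stab: "(\<lambda>x. a * x + b) ` ?B = ?B" .
  have "a = 1"
    using ind_stabilizer_scale[OF cop _ stab] q r by (simp add: a_def)
  then have stab: "(\<lambda>x. x + b) ` ?B = ?B" using stab by simp
  have "ind i (b + y) = ind i y" for y
  proof -
    have iff: "x + b \<in> ?B" if "x \<in> ?B" for x
      using that stab by blast
    have "b + y \<in> ?B \<longleftrightarrow> y \<in> ?B"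
      using iff[of y] iff[of "b + y"] by (auto simp: add_ac)
    then show ?thesis using ind_cases[of i y] ind_cases[of i "b + y"] by auto
  qed
  then have "b = 0" by (rule ind_no_period[OF assms])
  then show "q = r"
    using \<open>a = 1\<close> q r by (simp add: a_def b_def prod_eq_iff add_eq_0_iff_eq)
qed

text \<open>By the trivial stabiliser, blocks are counted as affine maps; \<open>T\<close> lies in
  the image of the block exactly when the inverse map sends \<open>T\<close> into it.\<close>

lemma card_blocks_containing:
  assumes "odd i" and cop: "coprime i n" and "card T = 3"
  shows "real (card {X \<in> GA1_orbit {y. ind i y = - 1}. T \<subseteq> X}) = 2 ^ n * (2 ^ n - 4) / 8"
proof -
  let ?B = "{y. ind i y = - 1}"
  obtain x1 x2 x3 where T: "T = {x1, x2, x3}" and x: "x1 \<noteq> x2" "x1 \<noteq> x3" "x2 \<noteq> x3"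
    using assms(3) by (auto simp: card_3_iff)
  let ?S = "{q. fst q \<noteq> 0 \<and> T \<subseteq> (\<lambda>x. fst q * x + snd q) ` ?B}"
  let ?S' = "{q. fst q \<noteq> 0 \<and> (\<forall>x\<in>T. ind i (fst q * x + snd q) = - 1)}"
  have "{X \<in> GA1_orbit ?B. T \<subseteq> X} = (\<lambda>q. (\<lambda>x. fst q * x + snd q) ` ?B) ` ?S"
    unfolding GA1_orbit_eq by blast
  moreover have "inj_on (\<lambda>q. (\<lambda>x. fst q * x + snd q) ` ?B) ?S"
    by (rule inj_on_subset[OF inj_on_affine_images[OF assms(1,2)]]) auto
  ultimately have "card {X \<in> GA1_orbit ?B. T \<subseteq> X} = card ?S"
    by (simp add: card_image)
  also have "\<dots> = card ?S'"
  \<comment> \<open>Inversion of affine maps, without a sign in characteristic two, and an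
    involution.\<close>
  proof (rule bij_betw_same_card[of "\<lambda>q. (1 / fst q, snd q / fst q)"], rule bij_betw_byWitness[where f' = "\<lambda>q. (1 / fst q, snd q / fst q)"])
    have mem: "x \<in> (\<lambda>x. a * x + b) ` ?B \<longleftrightarrow> ind i (1 / a * x + b / a) = - 1" if "a \<noteq> 0" for a b x
    proof
      assume "x \<in> (\<lambda>x. a * x + b) ` ?B"
      then obtain y where y: "ind i y = - 1" "x = a * y + b" by auto
      have "1 / a * x + b / a = y"
        using that by (simp add: y(2) add_divide_distrib add.assoc)
      then show "ind i (1 / a * x + b / a) = - 1" using y by simp
    next
      assume "ind i (1 / a * x + b / a) = - 1"
      moreover have "x = a * (1 / a * x + b / a) + b"
        using that by (simp add: distrib_left add.assoc)
      ultimately show "x \<in> (\<lambda>x. a * x + b) ` ?B" by blast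
    qed
    show "(\<lambda>q. (1 / fst q, snd q / fst q)) ` ?S \<subseteq> ?S'"
    proof clarify
      fix a b assume ab: "fst (a, b) \<noteq> 0" "T \<subseteq> (\<lambda>x. fst (a, b) * x + snd (a, b)) ` ?B"
      then have "ind i (1 / a * x + b / a) = - 1" if "x \<in> T" for x
        using that by (subst mem[symmetric]) auto
      then show "fst (1 / fst (a, b), snd (a, b) / fst (a, b)) \<noteq> 0 \<and>
        (\<forall>x\<in>T. ind i (fst (1 / fst (a, b), snd (a, b) / fst (a, b)) * x +
          snd (1 / fst (a, b), snd (a, b) / fst (a, b))) = - 1)"
        using ab by simp
    qed
    show "(\<lambda>q. (1 / fst q, snd q / fst q)) ` ?S' \<subseteq> ?S"
    proof clarify
      fix a b assume ab: "fst (a, b) \<noteq> 0" "\<forall>x\<in>T. ind i (fst (a, b) * x + snd (a, b)) = - 1"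
      then have "x \<in> (\<lambda>x. 1 / a * x + b / a) ` ?B" if "x \<in> T" for x
        using that by (subst mem) auto
      then show "fst (1 / fst (a, b), snd (a, b) / fst (a, b)) \<noteq> 0 \<and>
        T \<subseteq> (\<lambda>x. fst (1 / fst (a, b), snd (a, b) / fst (a, b)) * x + snd (1 / fst (a, b), snd (a, b) / fst (a, b))) ` ?B"
        using ab by auto
    qed
  qed (auto simp: prod_eq_iff)
  finally show ?thesis
    using card_affine_triples[OF assms(1,2) x] by (simp only: T)
qed

lemma design3_ind:
  assumes "odd i" and cop: "coprime i n"
  shows "design3 UNIV (GA1_orbit {y. ind i y = - 1}) (2 ^ n) (2 ^ n div 2) (2 ^ n * (2 ^ n - 4) / 8)"
  unfolding design3_def
proof (intro conjI ballI allI impI)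
  fix X assume "X \<in> GA1_orbit {y. ind i y = - 1}"
  then obtain a b where X: "X = (\<lambda>x. a * x + b) ` {y. ind i y = - 1}" "a \<noteq> 0"
    by (auto simp: GA1_orbit_def)
  then have "card X = card {y. ind i y = - 1}"
    by (simp add: card_image inj_on_def)
  then show "card X = 2 ^ n div 2"
    using card_ind_neg[OF cop] by simp
qed (use card_field card_blocks_containing[OF assms] in auto)

section \<open>The Kasami exponent and the given block\<close>

lemma coprime_exponent:
  assumes "coprime i n"
  shows "coprime (2 ^ i + 1) (2 ^ n - 1 :: nat)"
proof (rule coprimeI)
  fix c :: nat assume c: "c dvd 2 ^ i + 1" "c dvd 2 ^ n - 1"
  have "int c dvd 2 ^ i + 1"
    using c(1) by (metis int_dvd_int_iff of_nat_1 of_nat_add of_nat_numeral of_nat_power)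
  then have i: "[2 ^ i = - 1] (mod int c)"
    by (simp add: cong_iff_dvd_diff)
  have "int (2 ^ n - 1) = 2 ^ n - 1" by simp
  then have n: "[2 ^ n = 1] (mod int c)"
    using c(2) by (metis cong_iff_dvd_diff int_dvd_int_iff)
  \<comment> \<open>Modulo \<open>c\<close> both \<open>2 ^ (2 * i)\<close> and \<open>2 ^ n\<close>
    are 1; since the exponents are coprime, so is \<open>2\<close>, whence
    \<open>c = 1\<close>.\<close>
  have "coprime (2 * i) n" using assms odd_n by simp
  from cong_solve_coprime_nat[OF this] obtain k where "[2 * i * k = 1] (mod n)"
    by auto
  then obtain u v where uv: "2 * i * k + n * u = 1 + n * v"
    by (metis cong_iff_lin_nat mult.commute)
  have "[2 ^ (2 * i * k + n * u) = ((2 ^ i) ^ 2) ^ k * (2 ^ n) ^ u] (mod int c)"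
    by (simp add: power_add mult.commute flip: power_mult)
  also have "[((2 ^ i) ^ 2) ^ k * (2 ^ n) ^ u = ((- 1) ^ 2) ^ k * 1 ^ u] (mod int c)"
    by (intro cong_mult cong_pow i n)
  finally have "[2 ^ (1 + n * v) = 1] (mod int c)"
    by (simp add: uv)
  moreover have "[2 * (2 ^ n) ^ v = 2 * 1 ^ v] (mod int c)"
    by (intro cong_mult cong_pow n cong_refl)
  ultimately have "[2 = 1] (mod int c)"
    by (simp add: power_add power_mult) (metis cong_sym cong_trans)
  then show "is_unit c" by (simp add: cong_iff_dvd_diff)
qed

text \<open>Fermat's theorem makes the inverse exponent undo the Gold power at nonzero
  \<open>u\<close>, and positivity of the exponent handles \<open>u = 0\<close>.\<close>

lemma eq_power_inv_exp_iff:
  assumes "coprime i n"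
  shows "y = u ^ inv_exp (2 ^ i + 1) (2 ^ n - 1) \<longleftrightarrow> y * fr i y = u"
proof -
  define m :: nat where "m = 2 ^ n - 1"
  define d where "d = inv_exp (2 ^ i + 1) m"
  have "(1::nat) < 2 ^ n" using n_pos by (intro one_less_power) auto
  then have "0 < m" by (simp add: m_def)
  then have d: "0 < d" "[(2 ^ i + 1) * d = 1] (mod m)"
    using inv_exp_cong[of "2 ^ i + 1" m] coprime_exponent[OF assms] by (simp_all add: d_def m_def)
  have u: "u ^ d * fr i (u ^ d) = u"
  proof (cases "u = 0")
    case False
    obtain k l where kl: "(2 ^ i + 1) * d + m * k = 1 + m * l"
      using d(2) by (metis cong_iff_lin_nat mult.commute)
    have m: "u ^ (m * k) = 1" for k
      using power_q_minus_1[OF False] by (simp add: m_def power_mult)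
    have "u ^ d * fr i (u ^ d) = u ^ ((2 ^ i + 1) * d)"
      by (simp add: fr_def power_add mult.commute flip: power_mult)
    also have "\<dots> = u ^ ((2 ^ i + 1) * d + m * k)"
      by (simp only: power_add m mult_1_right)
    also have "\<dots> = u"
      by (simp only: kl power_add m mult_1_right power_one_right)
    finally show ?thesis .
  qed (use d in simp)
  then have "y = u ^ d \<longleftrightarrow> y * fr i y = u"
    by (metis gold_inj[OF assms])
  then show ?thesis by (simp only: d_def m_def)
qed

lemma kasami_derivative:
  fixes x :: 'a and i :: nat
  defines "s \<equiv> 2 ^ (2 * i) - 2 ^ i + 1"
  shows "((x + 1) ^ s + x ^ s + 1) * fr i (x ^ 2 + x) = (fr i x + x) * fr i (fr i x + x)"
proof -
  have "2 ^ i \<le> (2 ^ (2 * i) :: nat)" by simp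
  \<comment> \<open>The additive form avoids truncated subtraction: \<open>z ^ s\<close> is only
    ever used multiplied by \<open>fr i z\<close>.\<close>
  then have "s + 2 ^ i = 2 ^ (2 * i) + 1" by (simp add: s_def)
  then have "z ^ s * z ^ (2 ^ i) = z * z ^ (2 ^ (i + i))" for z :: 'a
    by (metis power_add power_one_right mult.commute mult_2)
  then have s: "z ^ s * fr i z = z * fr i (fr i z)" for z
    unfolding fr_fr unfolding fr_def .
  have "((x + 1) ^ s + x ^ s + 1) * fr i (x ^ 2 + x) =
      ((x + 1) ^ s * fr i (x + 1)) * fr i x + (x ^ s * fr i x) * fr i (x + 1) + fr i x * fr i (x + 1)"
    by (simp add: algebra_simps power2_eq_square)
  also have "\<dots> = (x + 1) * fr i (fr i (x + 1)) * fr i x + x * fr i (fr i x) * fr i (x + 1) + fr i x * fr i (x + 1)"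
    by (simp only: s)
  also have "\<dots> = (fr i x + x) * fr i (fr i x + x)"
    by (simp add: algebra_simps)
  finally show ?thesis .
qed

text \<open>Writing \<open>x ^ 2 + x\<close> as the Gold power of \<open>w\<close>, the derivative
  identity becomes an equality of Gold powers of \<open>y * fr i w\<close> and
  \<open>fr i x + x\<close>, and injectivity removes the power. The degenerate \<open>x = 0\<close>
  and \<open>x = 1\<close> give \<open>y = 0\<close>.\<close>

lemma kasami_image_iff:
  fixes y :: 'a and i :: nat
  defines "s \<equiv> 2 ^ (2 * i) - 2 ^ i + 1"
  assumes "coprime i n"
  shows "(\<exists>x. y * fr i y = (x + 1) ^ s + x ^ s + 1) \<longleftrightarrow>
    y = 0 \<or> (\<exists>w x. w \<noteq> 0 \<and> w * fr i w = x ^ 2 + x \<and> y * fr i w = fr i x + x)"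
    (is "(\<exists>x. _ = ?D x) \<longleftrightarrow> _")
proof -
  have D: "?D x * fr i (x ^ 2 + x) = (fr i x + x) * fr i (fr i x + x)" for x
    unfolding s_def by (rule kasami_derivative)
  have s0: "s \<noteq> 0" by (simp add: s_def)
  have key: "(y * fr i w) * fr i (y * fr i w) = (y * fr i y) * fr i (w * fr i w)" for w
    by (simp add: mult_ac)
  show ?thesis
  proof
    assume "\<exists>x. y * fr i y = ?D x"
    then obtain x where x: "y * fr i y = ?D x" by blast
    show "y = 0 \<or> (\<exists>w x. w \<noteq> 0 \<and> w * fr i w = x ^ 2 + x \<and> y * fr i w = fr i x + x)"
    proof (cases "x ^ 2 + x = 0")
      case True
      then have "x = 0 \<or> x = 1" by (simp add: add_eq_0_iff_eq power2_eq_square)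
      then have "y * fr i y = 0" using x s0 by (auto simp: zero_power)
      then show ?thesis by simp
    next
      case False
      obtain w where w: "w * fr i w = x ^ 2 + x"
        using bij_gold[OF assms(2)] by (metis bij_pointE)
      then have "w \<noteq> 0" using False by auto
      moreover have "(y * fr i w) * fr i (y * fr i w) = (fr i x + x) * fr i (fr i x + x)"
        unfolding key w x by (rule D)
      then have "y * fr i w = fr i x + x" by (rule gold_inj[OF assms(2)])
      ultimately show ?thesis using w by blast
    qed
  next
    assume "y = 0 \<or> (\<exists>w x. w \<noteq> 0 \<and> w * fr i w = x ^ 2 + x \<and> y * fr i w = fr i x + x)"
    then show "\<exists>x. y * fr i y = ?D x"
    proof
      assume "y = 0"
      then show ?thesis using s0 by (intro exI[of _ 0]) (simp add: zero_power)
    next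
      assume "\<exists>w x. w \<noteq> 0 \<and> w * fr i w = x ^ 2 + x \<and> y * fr i w = fr i x + x"
      then obtain w x where wx: "w \<noteq> 0" "w * fr i w = x ^ 2 + x" "y * fr i w = fr i x + x" by blast
      then have "x ^ 2 + x \<noteq> 0" by (metis gold_eq_0_iff)
      then have nz: "fr i (x ^ 2 + x) \<noteq> 0" by (simp only: fr_eq_0_iff not_False_eq_True)
      have "(y * fr i y) * fr i (x ^ 2 + x) = (y * fr i w) * fr i (y * fr i w)"
        by (simp only: key wx(2))
      also have "\<dots> = ?D x * fr i (x ^ 2 + x)"
        unfolding wx(3) by (rule D[symmetric])
      finally have "y * fr i y = ?D x" using nz by simp
      then show ?thesis ..
    qed
  qed
qed

lemma kasami_block_eq:
  fixes i :: nat
  defines "s \<equiv> 2 ^ (2 * i) - 2 ^ i + 1"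
  assumes "coprime i n" and j: "coprime j n" "[i = j] (mod n)"
  shows "(UNIV :: 'a set) - {((x + 1) ^ s + x ^ s + 1) ^ inv_exp (2 ^ i + 1) (2 ^ n - 1) | x. True} =
    {y. ind j y = - 1}"
proof -
  have fr: "fr i = fr j" using fr_cong[OF j(2)] by auto
  have "y \<in> {((x + 1) ^ s + x ^ s + 1) ^ inv_exp (2 ^ i + 1) (2 ^ n - 1) | x. True} \<longleftrightarrow> ind j y = 1" for y
    unfolding ind_eq_1_iff[OF j(1)] fr[symmetric] kasami_image_iff[OF assms(2), symmetric] mem_Collect_eq
      eq_power_inv_exp_iff[OF assms(2)] s_def by simp
  moreover have "ind j y = - 1 \<longleftrightarrow> ind j y \<noteq> 1" for y
    using ind_cases[of j y] by auto
  ultimately show ?thesis by auto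
qed

end

theorem theorem12:
  fixes n i :: nat
  assumes "odd n" and "0 < i" and "coprime i n"
    and "card (UNIV :: 'a::{field,finite} set) = 2 ^ n"
  shows "let q = 2 ^ n; s = 2 ^ (2 * i) - 2 ^ i + 1; d = inv_exp (2 ^ i + 1) (q - 1);
             B = (UNIV :: 'a set) - {((x + 1) ^ s + x ^ s + 1) ^ d | x. True}
         in design3 (UNIV :: 'a set) (GA1_orbit B) q (q div 2)
              (real q * (real q - 4) / 8)"
proof -
  interpret odd_binary_field "TYPE('a)" n
    using assms by unfold_locales
  \<comment> \<open>As \<open>n\<close> is odd, one of \<open>i\<close> and \<open>i + n\<close> is
    odd, and both define the same Frobenius power.\<close>
  define j where "j = (if odd i then i else i + n)"
  have "coprime (i + n) n"
    using assms(3) by (metis coprime_iff_gcd_eq_1 gcd_add1)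
  then have j: "odd j" "coprime j n" "[i = j] (mod n)"
    using assms by (auto simp: j_def cong_def)
  show ?thesis
    unfolding Let_def kasami_block_eq[OF assms(3) j(2,3)]
    using design3_ind[OF j(1,2)] by simp
qed

end
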